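(* There exist absolute constants $c>0$, $C>0$ such that, for any integers $s,d$ satisfying $1\le s\le d$, and any $\sigma>0$, $$\sup_{\theta\in B_0(s)} \mathbf E_\theta\big(\hat N - \|\theta\|_2\big)^2 \le C\,\psi_\sigma^{\sqrt Q}(s,d),$$ and $$\inf_{\hat T}\sup_{\theta\in B_0(s)} \mathbf E_\theta\big(\hat T - \|\theta\|_2\big)^2 \ge c\,\psi_\sigma^{\sqrt Q}(s,d),$$ where $\inf_{\hat T}$ is the infimum over all estimators.
   Context: Model: one observes $y_j=\theta_j+\sigma\xi_j$, $j=1,\dots,d$, where $\theta=(\theta_1,\dots,\theta_d)\in\mathbb R^d$ is unknown, $\xi_1,\dots,\xi_d$ are i.i.d. standard normal and $\sigma>0$. $\mathbf P_\theta$ is the law of $(y_1,\dots,y_d)$ and $\mathbf E_\theta$ the corresponding expectation. An estimator is a measurable real-valued function of $(y_1,\dots,y_d)$ (it may depend on known parameters). $\|\theta\|_2=\big(\sum_{i=1}^d\theta_i^2\big)^{1/2}$; $\|\theta\|_0$ is the number of non-zero components of $\theta$; $B_0(s)=\{\theta\in\mathbb R^d:\|\theta\|_0\le s\}$. $$\psi_\sigma^{\sqrt Q}(s,d)=\begin{cases}\sigma^2s\log(1+d/s^2)&\text{if } s<\sqrt d,\\ \sigma^2\sqrt d&\text{if } s\ge\sqrt d.\end{cases}$$ With $X\sim\mathcal N(0,1)$, set $\alpha_s=\mathbf E\big(X^2\mid X^2>2\log(1+d/s^2)\big)$. The estimator is $\hat N=\sqrt{\max\{\hat Q_\bullet,0\}}$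 where $$\hat Q_\bullet=\begin{cases}\sum_{j=1}^d(y_j^2-\alpha_s\sigma^2)\,\mathbf 1_{\{|y_j|>\sigma\sqrt{2\log(1+d/s^2)}\}}&\text{if } s<\sqrt d,\\ \sum_{j=1}^d y_j^2-d\sigma^2&\text{if } s\ge\sqrt d.\end{cases}$$ *)

theory Defs
  imports "HOL-Probability.Probability"
begin

text \<open>
  Vectors in \<open>\<real>\<^sup>d\<close> are the points of \<open>obs_space d\<close>: functions on \<open>nat\<close> that are \<open>undefined\<close>
  outside \<open>{..<d}\<close>, with coordinates numbered from \<open>0\<close>.
\<close>

definition obs_space :: "nat \<Rightarrow> (nat \<Rightarrow> real) measure" where
  "obs_space d = (\<Pi>\<^sub>M j\<in>{..<d}. borel)"

definition noise_law :: "nat \<Rightarrow> (nat \<Rightarrow> real) measure" where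
  "noise_law d = (\<Pi>\<^sub>M j\<in>{..<d}. density lborel std_normal_density)"

definition obs_law :: "nat \<Rightarrow> real \<Rightarrow> (nat \<Rightarrow> real) \<Rightarrow> (nat \<Rightarrow> real) measure" where
  "obs_law d \<sigma> \<theta> =
     distr (noise_law d) (obs_space d) (\<lambda>\<xi>. \<lambda>j\<in>{..<d}. \<theta> j + \<sigma> * \<xi> j)"

definition l0_norm :: "nat \<Rightarrow> (nat \<Rightarrow> real) \<Rightarrow> nat" where
  "l0_norm d \<theta> = card {j \<in> {..<d}. \<theta> j \<noteq> 0}"

definition l2_norm :: "nat \<Rightarrow> (nat \<Rightarrow> real) \<Rightarrow> real" where
  "l2_norm d \<theta> = L2_set \<theta> {..<d}"

definition B0 :: "nat \<Rightarrow> nat \<Rightarrow> (nat \<Rightarrow> real) set" where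
  "B0 d s = {\<theta> \<in> space (obs_space d). l0_norm d \<theta> \<le> s}"

definition estimators :: "nat \<Rightarrow> ((nat \<Rightarrow> real) \<Rightarrow> real) set" where
  "estimators d = borel_measurable (obs_space d)"

text \<open>The mean squared error may be infinite, so it is taken in \<open>ennreal\<close>.\<close>

definition norm_risk ::
  "nat \<Rightarrow> real \<Rightarrow> ((nat \<Rightarrow> real) \<Rightarrow> real) \<Rightarrow> (nat \<Rightarrow> real) \<Rightarrow> ennreal" where
  "norm_risk d \<sigma> T \<theta> = (\<integral>\<^sup>+ y. ennreal ((T y - l2_norm d \<theta>)\<^sup>2) \<partial>obs_law d \<sigma> \<theta>)"

definition psi_sqrtQ :: "real \<Rightarrow> nat \<Rightarrow> nat \<Rightarrow> real" where
  "psi_sqrtQ \<sigma> s d =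
     (if real s < sqrt (real d) then \<sigma>\<^sup>2 * real s * ln (1 + real d / (real s)\<^sup>2)
      else \<sigma>\<^sup>2 * sqrt (real d))"

text \<open>
  \<open>uniform_measure M A\<close> is \<open>M\<close> conditioned on the event \<open>A\<close>, so the integral below is the
  elementary conditional expectation of \<open>X\<^sup>2\<close> given \<open>X\<^sup>2 > 2 log (1 + d/s\<^sup>2)\<close> for a
  standard normal \<open>X\<close>.
\<close>

definition alpha :: "nat \<Rightarrow> nat \<Rightarrow> real" where
  "alpha d s =
     (\<integral>x. x\<^sup>2 \<partial>uniform_measure (density lborel std_normal_density)
                 {x. x\<^sup>2 > 2 * ln (1 + real d / (real s)\<^sup>2)})"

definition Q_hat :: "real \<Rightarrow> nat \<Rightarrow> nat \<Rightarrow> (nat \<Rightarrow> real) \<Rightarrow> real" where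
  "Q_hat \<sigma> s d y =
     (if real s < sqrt (real d)
      then \<Sum>j<d. ((y j)\<^sup>2 - alpha d s * \<sigma>\<^sup>2) *
             indicator {t. \<bar>t\<bar> > \<sigma> * sqrt (2 * ln (1 + real d / (real s)\<^sup>2))} (y j)
      else (\<Sum>j<d. (y j)\<^sup>2) - real d * \<sigma>\<^sup>2)"

definition N_hat :: "real \<Rightarrow> nat \<Rightarrow> nat \<Rightarrow> (nat \<Rightarrow> real) \<Rightarrow> real" where
  "N_hat \<sigma> s d y = sqrt (max (Q_hat \<sigma> s d y) 0)"

lemma N_hat_in_estimators: "N_hat \<sigma> s d \<in> estimators d"
proof -
  have "Q_hat \<sigma> s d \<in> borel_measurable (obs_space d)"
    unfolding Q_hat_def[abs_def] obs_space_def by measurable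
  then show ?thesis
    unfolding N_hat_def[abs_def] estimators_def by measurable
qed

lemma prob_space_obs_law: "prob_space (obs_law d \<sigma> \<theta>)"
proof -
  have "prob_space (noise_law d)"
    unfolding noise_law_def by (intro prob_space_PiM prob_space_normal_density) simp
  moreover have "(\<lambda>\<xi>. \<lambda>j\<in>{..<d}. \<theta> j + \<sigma> * \<xi> j) \<in> measurable (noise_law d) (obs_space d)"
    unfolding noise_law_def obs_space_def by measurable
  ultimately show ?thesis
    unfolding obs_law_def by (rule prob_space.prob_space_distr)
qed

end

theory Submission
  imports Defs "HOL-Real_Asymp.Real_Asymp"
begin

text \<open>
  Upper bound: after rescaling to \<open>\<sigma> = 1\<close>, the error \<open>D\<close> of \<open>Q_hat\<close> as an estimator of \<open>\<parallel>\<theta>\<parallel>\<^sup>2\<close> splits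
  into a linear term \<open>2 \<Sum> \<theta>\<^sub>j \<xi>\<^sub>j\<close>, centred sums over the zero and the non-zero coordinates, and a
  bounded remainder, so \<open>E D\<^sup>2 \<le> K (\<parallel>\<theta>\<parallel>\<^sup>2 + B\<^sup>2)\<close> where \<open>B\<close> is of the order of the claimed rate. The
  elementary bounds \<open>(N_hat - \<parallel>\<theta>\<parallel>)\<^sup>2 \<le> \<bar>D\<bar>\<close> and \<open>(N_hat - \<parallel>\<theta>\<parallel>)\<^sup>2 \<le> D\<^sup>2 / \<parallel>\<theta>\<parallel>\<^sup>2\<close> then give a risk of
  order \<open>B\<close>.

  Lower bound: cut the first \<open>s * m\<close> coordinates into \<open>s\<close> blocks of length \<open>m = d div s\<close> and put one spike
  of height \<open>\<rho> = sqrt (log (1 + d/s\<^sup>2))\<close> at an independent uniform position of each block. All these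
  vectors have norm \<open>N = \<rho> sqrt s\<close>. Two such vectors agree in a binomial number of blocks, so the
  density \<open>g\<close> of the mixture with respect to pure noise satisfies
  \<open>E g\<^sup>2 = (1 + (exp \<rho>\<^sup>2 - 1) / m) ^ s \<le> (1 + 2/s) ^ s \<le> exp 2\<close>. Hence
  \<open>N = E (g N) \<le> E (g \<bar>T - N\<bar>) + E (g \<bar>T\<bar>)\<close> is bounded by a constant times the square root of the
  maximal risk of \<open>T\<close>. For \<open>s \<ge> sqrt d\<close> the bound at sparsity \<open>\<lfloor>sqrt d\<rfloor>\<close> suffices.
\<close>

section \<open>Tail moments of the standard normal law\<close>

abbreviation std_normal :: "real measure" where
  "std_normal \<equiv> density lborel (\<lambda>x. ennreal (std_normal_density x))"

lemma prob_space_std_normal: "prob_space std_normal"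
  by (rule prob_space_normal_density) simp

lemma std_normal_density_DERIV:
  "(std_normal_density has_real_derivative - x * std_normal_density x) (at x)"
proof -
  have "((\<lambda>x. c * exp (- x\<^sup>2 / 2)) has_real_derivative - x * (c * exp (- x\<^sup>2 / 2))) (at x)" for c
    by (auto intro!: derivative_eq_intros)
  from this[of "1 / sqrt (2 * pi)"] show ?thesis
    unfolding std_normal_density_def[abs_def] .
qed

text \<open>The integrand is the derivative of \<open>- p * std_normal_density\<close>.\<close>

lemma nn_integral_std_normal_tail_FTC:
  assumes deriv: "\<And>x. \<tau> \<le> x \<Longrightarrow> (p has_real_derivative p' x) (at x)"
    and nonneg: "\<And>x. \<tau> \<le> x \<Longrightarrow> 0 \<le> x * p x - p' x"
    and [measurable]: "p \<in> borel_measurable borel" "p' \<in> borel_measurable borel"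
    and lim: "((\<lambda>x. p x * std_normal_density x) \<longlongrightarrow> 0) at_top"
  shows "(\<integral>\<^sup>+x. ennreal ((x * p x - p' x) * std_normal_density x) * indicator {\<tau>..} x \<partial>lborel)
    = ennreal (p \<tau> * std_normal_density \<tau>)"
proof -
  have "(\<integral>\<^sup>+x. ennreal ((x * p x - p' x) * std_normal_density x) * indicator {\<tau>..} x \<partial>lborel)
      = 0 - (- (p \<tau> * std_normal_density \<tau>))"
  proof (rule nn_integral_FTC_atLeast)
    show "((\<lambda>x. - (p x * std_normal_density x)) has_real_derivative
        (x * p x - p' x) * std_normal_density x) (at x)" if "\<tau> \<le> x" for x
      by (rule DERIV_cong[OF DERIV_minus[OF DERIV_mult[OF deriv[OF that] std_normal_density_DERIV]]])
        (simp add: algebra_simps)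
    show "((\<lambda>x. - (p x * std_normal_density x)) \<longlongrightarrow> 0) at_top"
      using tendsto_minus[OF lim] by simp
  qed (use nonneg in auto)
  then show ?thesis by simp
qed

text \<open>Write x^2 = (x^2 - 1) + 1. The first part integrates exactly to
  \<open>\<tau> * std_normal_density \<tau>\<close>. The function 1 + 1/x^2 integrates to
  \<open>std_normal_density \<tau> / \<tau>\<close> and is at most 2 on the tail, so this boundary
  value is at most twice the tail mass. The outcome bounds the conditional second moment
  \<open>alpha\<close> by 3 \<tau>^2.\<close>

lemma std_normal_tail_second_moment:
  fixes \<tau> :: real
  assumes "1 \<le> \<tau>"
  shows "(\<integral>\<^sup>+x. ennreal (x\<^sup>2 * std_normal_density x) * indicator {\<tau>..} x \<partial>lborel)
    \<le> ennreal (3 * \<tau>\<^sup>2) * (\<integral>\<^sup>+x. ennreal (std_normal_density x) * indicator {\<tau>..} x \<partial>lborel)"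
    (is "?I2 \<le> _ * ?I0")
proof -
  have a: "(\<integral>\<^sup>+x. ennreal ((x * x - 1) * std_normal_density x) * indicator {\<tau>..} x \<partial>lborel)
      = ennreal (\<tau> * std_normal_density \<tau>)"
  proof (rule nn_integral_std_normal_tail_FTC)
    show "((\<lambda>x. x * std_normal_density x) \<longlongrightarrow> 0) at_top"
      unfolding std_normal_density_def by real_asymp
    show "0 \<le> x * x - 1" if "\<tau> \<le> x" for x
      using mult_mono[of 1 x 1 x] that assms by simp
  qed auto
  have b: "(\<integral>\<^sup>+x. ennreal ((x * (1 / x) - (- 1 / x\<^sup>2)) * std_normal_density x) * indicator {\<tau>..} x \<partial>lborel)
      = ennreal (1 / \<tau> * std_normal_density \<tau>)"
  proof (rule nn_integral_std_normal_tail_FTC)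
    show "((\<lambda>x. 1 / x * std_normal_density x) \<longlongrightarrow> 0) at_top"
      unfolding std_normal_density_def by real_asymp
    show "((\<lambda>x. 1 / x) has_real_derivative - 1 / x\<^sup>2) (at x)" if "\<tau> \<le> x" for x
      using that assms by (auto intro!: derivative_eq_intros simp: power2_eq_square)
    show "0 \<le> x * (1 / x) - - 1 / x\<^sup>2" if "\<tau> \<le> x" for x
      using that assms by simp
  qed auto
  have "ennreal (1 / \<tau> * std_normal_density \<tau>) \<le> (\<integral>\<^sup>+x. 2 * (ennreal (std_normal_density x) * indicator {\<tau>..} x) \<partial>lborel)"
    unfolding b[symmetric]
  proof (rule nn_integral_mono)
    fix x
    show "ennreal ((x * (1 / x) - (- 1 / x\<^sup>2)) * std_normal_density x) * indicator {\<tau>..} x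
        \<le> 2 * (ennreal (std_normal_density x) * indicator {\<tau>..} x)"
    proof (cases "\<tau> \<le> x")
      case True
      then have "x * (1 / x) - (- 1 / x\<^sup>2) \<le> 2"
        using assms by simp
      then have "ennreal ((x * (1 / x) - (- 1 / x\<^sup>2)) * std_normal_density x) \<le> ennreal (2 * std_normal_density x)"
        by (intro ennreal_leI mult_right_mono) auto
      then show ?thesis using True by (simp add: ennreal_mult)
    qed auto
  qed
  also have "\<dots> = 2 * ?I0"
    by (rule nn_integral_cmult) simp
  finally have c: "ennreal (1 / \<tau> * std_normal_density \<tau>) \<le> 2 * ?I0" .
  have "?I2 = (\<integral>\<^sup>+x. ennreal ((x * x - 1) * std_normal_density x) * indicator {\<tau>..} x
      + ennreal (std_normal_density x) * indicator {\<tau>..} x \<partial>lborel)"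
  proof (rule nn_integral_cong)
    fix x
    show "ennreal (x\<^sup>2 * std_normal_density x) * indicator {\<tau>..} x
      = ennreal ((x * x - 1) * std_normal_density x) * indicator {\<tau>..} x
      + ennreal (std_normal_density x) * indicator {\<tau>..} x"
    proof (cases "\<tau> \<le> x")
      case True
      then have "0 \<le> x * x - 1"
        using mult_mono[of 1 x 1 x] assms by simp
      then have "ennreal ((x * x - 1) * std_normal_density x) + ennreal (std_normal_density x)
          = ennreal ((x * x - 1) * std_normal_density x + std_normal_density x)"
        by (simp add: ennreal_plus)
      then show ?thesis
        using True by (simp add: power2_eq_square algebra_simps)
    qed simp
  qed
  also have "\<dots> = ennreal (\<tau> * std_normal_density \<tau>) + ?I0"
    unfolding a[symmetric] by (rule nn_integral_add) auto
  also have "ennreal (\<tau> * std_normal_density \<tau>) = ennreal (\<tau>\<^sup>2) * ennreal (1 / \<tau> * std_normal_density \<tau>)"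
    using assms by (simp add: ennreal_mult[symmetric] power2_eq_square)
  also have "\<dots> + ?I0 \<le> ennreal (\<tau>\<^sup>2) * (2 * ?I0) + ennreal (\<tau>\<^sup>2) * ?I0"
  proof (rule add_mono)
    have "1 \<le> ennreal (\<tau>\<^sup>2)"
      using assms by (simp add: one_le_power)
    then show "?I0 \<le> ennreal (\<tau>\<^sup>2) * ?I0"
      using mult_right_mono[of 1 "ennreal (\<tau>\<^sup>2)" ?I0] by simp
  qed (rule mult_left_mono[OF c], simp)
  also have "\<dots> = ennreal (3 * \<tau>\<^sup>2) * ?I0"
  proof -
    have "3 * a * b = a * (2 * b) + a * b" for a b :: ennreal
    proof -
      have "3 * a * b = (2 + 1) * (a * b)"
        by (simp add: mult.assoc)
      also have "\<dots> = 2 * (a * b) + a * b"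
        unfolding distrib_right by simp
      finally show ?thesis
        by (simp add: ac_simps)
    qed
    then show ?thesis
      by (simp add: ennreal_mult)
  qed
  finally show ?thesis .
qed

text \<open>Adding 3/x^2 to x^4 makes the integrand an exact derivative, so only the boundary value
  of \<open>p\<close> remains; for \<open>1 \<le> \<tau>\<close> its coefficients give 1 + 3 + 3 =
  7. The factor \<open>exp (- \<tau>\<^sup>2 / 2)\<close> is kept because it later compensates for
  the number of zero coordinates.\<close>

lemma std_normal_tail_fourth_moment:
  fixes \<tau> :: real
  assumes "1 \<le> \<tau>"
  shows "(\<integral>\<^sup>+x. ennreal (x ^ 4 * std_normal_density x) * indicator {\<tau>..} x \<partial>lborel)
    \<le> ennreal (7 * \<tau> ^ 4 * exp (- \<tau>\<^sup>2 / 2))"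
proof -
  \<comment> \<open>\<open>p\<close> is chosen so that \<open>x * p x - p' x = x ^ 4 + 3 / x\<^sup>2\<close>.\<close>
  define p where "p = (\<lambda>x::real. x ^ 3 + 3 * x + 3 / x)"
  define p' where "p' = (\<lambda>x::real. 3 * x\<^sup>2 + 3 - 3 / x\<^sup>2)"
  have p: "x * p x - p' x = x ^ 4 + 3 / x\<^sup>2" if "\<tau> \<le> x" for x
    using that assms by (simp add: p_def p'_def field_simps power2_eq_square power3_eq_cube power4_eq_xxxx)
  have "(\<integral>\<^sup>+x. ennreal (x ^ 4 * std_normal_density x) * indicator {\<tau>..} x \<partial>lborel)
    \<le> (\<integral>\<^sup>+x. ennreal ((x * p x - p' x) * std_normal_density x) * indicator {\<tau>..} x \<partial>lborel)"
    by (intro nn_integral_mono) (auto split: split_indicator simp: p intro!: ennreal_leI mult_right_mono)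
  also have "\<dots> = ennreal (p \<tau> * std_normal_density \<tau>)"
  proof (rule nn_integral_std_normal_tail_FTC)
    show "(p has_real_derivative p' x) (at x)" if "\<tau> \<le> x" for x
      unfolding p_def p'_def using that assms
      by (auto intro!: derivative_eq_intros simp: power2_eq_square)
    show "((\<lambda>x. p x * std_normal_density x) \<longlongrightarrow> 0) at_top"
      unfolding std_normal_density_def p_def by real_asymp
    show "0 \<le> x * p x - p' x" if "\<tau> \<le> x" for x
      using that by (simp add: p)
  qed (auto simp: p_def[abs_def] p'_def[abs_def])
  also have "\<dots> \<le> ennreal (7 * \<tau> ^ 4 * exp (- \<tau>\<^sup>2 / 2))"
  proof (intro ennreal_leI mult_mono)
    have "\<tau> \<le> \<tau> ^ 4" "\<tau> ^ 3 \<le> \<tau> ^ 4" "1 / \<tau> \<le> 1" "1 \<le> \<tau> ^ 4"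
      using assms by (auto intro: power_increasing self_le_power)
    then show "p \<tau> \<le> 7 * \<tau> ^ 4" by (simp add: p_def)
    have "1 / sqrt (2 * pi) \<le> 1"
      using pi_gt3 by (simp add: field_simps)
    then show "std_normal_density \<tau> \<le> exp (- \<tau>\<^sup>2 / 2)"
      unfolding std_normal_density_def by (rule mult_left_le_one_le[rotated 2]) auto
  qed auto
  finally show ?thesis .
qed

text \<open>By evenness the two half-lines contribute equally, which transfers the one-sided tail
  bounds to the symmetric event of \<open>alpha\<close>.\<close>

lemma nn_integral_std_normal_even_tail:
  fixes h :: "real \<Rightarrow> real"
  assumes [measurable]: "h \<in> borel_measurable borel" and even: "\<And>x. h (- x) = h x"
    and nonneg: "\<And>x. 0 \<le> h x" and \<tau>: "0 < \<tau>"
  shows "(\<integral>\<^sup>+x. ennreal (h x * indicator {x. \<tau>\<^sup>2 < x\<^sup>2} x) \<partial>std_normal)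
    = 2 * (\<integral>\<^sup>+x. ennreal (h x * std_normal_density x) * indicator {\<tau>..} x \<partial>lborel)"
proof -
  let ?g = "\<lambda>x. ennreal (h x * std_normal_density x) * indicator {\<tau>..} x"
  have "(\<integral>\<^sup>+x. ennreal (h x * indicator {x. \<tau>\<^sup>2 < x\<^sup>2} x) \<partial>std_normal)
      = (\<integral>\<^sup>+x. ennreal (std_normal_density x) * ennreal (h x * indicator {x. \<tau>\<^sup>2 < x\<^sup>2} x) \<partial>lborel)"
    by (rule nn_integral_density) auto
  also have "\<dots> = (\<integral>\<^sup>+x. ?g x + ?g (0 + (-1) * x) \<partial>lborel)"
  proof (rule nn_integral_cong_AE)
    \<comment> \<open>The strict inequality in the event and the closed half-lines differ only at
      these two points.\<close>
    have "AE x in lborel. x \<noteq> \<tau> \<and> x \<noteq> - \<tau>"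
      by (intro AE_conjI AE_lborel_singleton)
    then show "AE x in lborel. ennreal (std_normal_density x) * ennreal (h x * indicator {x. \<tau>\<^sup>2 < x\<^sup>2} x)
        = ?g x + ?g (0 + (-1) * x)"
    proof eventually_elim
      case (elim x)
      have "\<tau>\<^sup>2 < x\<^sup>2 \<longleftrightarrow> \<tau> < \<bar>x\<bar>"
        using abs_le_square_iff[of x \<tau>] \<tau> by linarith
      then show ?case
        using elim \<tau> nonneg
        by (auto split: split_indicator simp: even ennreal_mult[symmetric] std_normal_density_def ac_simps abs_if)
    qed
  qed
  also have "\<dots> = (\<integral>\<^sup>+x. ?g x \<partial>lborel) + (\<integral>\<^sup>+x. ?g (0 + (-1) * x) \<partial>lborel)"
    by (rule nn_integral_add) auto
  also have "(\<integral>\<^sup>+x. ?g (0 + (-1) * x) \<partial>lborel) = (\<integral>\<^sup>+x. ?g x \<partial>lborel)"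
    using nn_integral_real_affine[of ?g "-1" 0] by simp
  finally show ?thesis
    by (simp add: mult_2)
qed

section \<open>Moments and the thresholded square of a standard normal variable\<close>

lemma integrable_std_normal_power: "integrable std_normal (\<lambda>x. x ^ k)"
  using integrable_std_normal_moment[of k] by (subst integrable_density) auto

lemma integral_std_normal_power:
  "(\<integral>x. x ^ k \<partial>std_normal) = (\<integral>x. std_normal_density x * x ^ k \<partial>lborel)"
  by (subst integral_density) auto

lemma std_normal_moments:
  shows "(\<integral>x. x \<partial>std_normal) = 0" "(\<integral>x. x\<^sup>2 \<partial>std_normal) = 1" "(\<integral>x. x ^ 4 \<partial>std_normal) = 3"
  using integral_std_normal_power[of 1] integral_std_normal_power[of 2] integral_std_normal_power[of 4]
    integral_std_normal_moment_odd[of 0] integral_std_normal_moment_even[of 1]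
    integral_std_normal_moment_even[of 2]
  by (simp_all add: fact_numeral)

lemma std_normal_centered_square:
  shows "integrable std_normal (\<lambda>x. x\<^sup>2 - 1)" "(\<integral>x. x\<^sup>2 - 1 \<partial>std_normal) = 0"
    "integrable std_normal (\<lambda>x. (x\<^sup>2 - 1)\<^sup>2)" "(\<integral>x. (x\<^sup>2 - 1)\<^sup>2 \<partial>std_normal) = 2"
proof -
  interpret prob_space std_normal by (rule prob_space_std_normal)
  note int = integrable_std_normal_power[of 2] integrable_std_normal_power[of 4]
  have eq: "(x\<^sup>2 - 1)\<^sup>2 = x ^ 4 - 2 * x\<^sup>2 + 1" for x :: real
    by (simp add: power2_eq_square power4_eq_xxxx algebra_simps)
  show "integrable std_normal (\<lambda>x. x\<^sup>2 - 1)" "integrable std_normal (\<lambda>x. (x\<^sup>2 - 1)\<^sup>2)"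
    unfolding eq using int by auto
  show "(\<integral>x. x\<^sup>2 - 1 \<partial>std_normal) = 0"
    using int by (subst Bochner_Integration.integral_diff) (auto simp: std_normal_moments prob_space[simplified])
  have "(\<integral>x. (x\<^sup>2 - 1)\<^sup>2 \<partial>std_normal) = (\<integral>x. x ^ 4 - 2 * x\<^sup>2 \<partial>std_normal) + (\<integral>x. 1 \<partial>std_normal)"
    unfolding eq using int by (intro Bochner_Integration.integral_add) auto
  also have "(\<integral>x. x ^ 4 - 2 * x\<^sup>2 \<partial>std_normal) = (\<integral>x. x ^ 4 \<partial>std_normal) - (\<integral>x. 2 * x\<^sup>2 \<partial>std_normal)"
    using int by (intro Bochner_Integration.integral_diff) auto
  finally show "(\<integral>x. (x\<^sup>2 - 1)\<^sup>2 \<partial>std_normal) = 2"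
    by (simp add: std_normal_moments prob_space[simplified])
qed

text \<open>Subtracting the conditional mean \<alpha> is exactly what centres the thresholded
  square. Coordinates carrying pure noise therefore add no bias to \<open>Q_hat\<close>, and their
  variance inherits the factor \<open>exp (- \<tau>\<^sup>2 / 2)\<close>.\<close>

lemma std_normal_tail_conditional:
  fixes \<tau> :: real
  defines "A \<equiv> {x::real. \<tau>\<^sup>2 < x\<^sup>2}"
  defines "\<alpha> \<equiv> (\<integral>x. x\<^sup>2 \<partial>uniform_measure std_normal A)"
  assumes \<tau>: "1 \<le> \<tau>"
  shows "0 \<le> \<alpha>" and "\<alpha> \<le> 3 * \<tau>\<^sup>2"
    and "integrable std_normal (\<lambda>x. (x\<^sup>2 - \<alpha>) * indicator A x)"
    and "(\<integral>x. (x\<^sup>2 - \<alpha>) * indicator A x \<partial>std_normal) = 0"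
    and "integrable std_normal (\<lambda>x. ((x\<^sup>2 - \<alpha>) * indicator A x)\<^sup>2)"
    and "(\<integral>x. ((x\<^sup>2 - \<alpha>) * indicator A x)\<^sup>2 \<partial>std_normal) \<le> 280 * \<tau> ^ 4 * exp (- \<tau>\<^sup>2 / 2)"
proof -
  interpret prob_space std_normal by (rule prob_space_std_normal)
  have A[measurable]: "A \<in> sets borel"
    unfolding A_def by measurable
  have int: "integrable std_normal (\<lambda>x. x ^ k * indicator A x)" for k
    using integrable_std_normal_power[of k] by (intro integrable_real_mult_indicator) auto
  let ?I = "\<lambda>k::nat. \<integral>x. x ^ k * indicator A x \<partial>std_normal"
  have nn: "ennreal (?I k) = 2 * (\<integral>\<^sup>+x. ennreal (x ^ k * std_normal_density x) * indicator {\<tau>..} x \<partial>lborel)"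
    if "even k" for k
  proof -
    have "ennreal (?I k) = (\<integral>\<^sup>+x. ennreal (x ^ k * indicator A x) \<partial>std_normal)"
      using int that by (intro nn_integral_eq_integral[symmetric]) (auto intro!: AE_I2 mult_nonneg_nonneg zero_le_even_power)
    also have "\<dots> = 2 * (\<integral>\<^sup>+x. ennreal (x ^ k * std_normal_density x) * indicator {\<tau>..} x \<partial>lborel)"
      unfolding A_def using that \<tau> by (intro nn_integral_std_normal_even_tail) (auto simp: zero_le_even_power)
    finally show ?thesis .
  qed
  have nonneg: "0 \<le> ?I k" if "even k" for k
    using that by (intro integral_nonneg_AE AE_I2) (auto intro!: mult_nonneg_nonneg zero_le_even_power)
  have I0: "?I 0 = prob A"
    by simp
  have "ennreal (?I 2) \<le> ennreal (3 * \<tau>\<^sup>2) * ennreal (?I 0)"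
    using mult_left_mono[OF std_normal_tail_second_moment[OF \<tau>], of 2]
    by (subst (1 2) nn) (simp_all add: ac_simps)
  also have "\<dots> = ennreal (3 * \<tau>\<^sup>2 * ?I 0)"
    using nonneg[of 0] by (simp add: ennreal_mult)
  finally have I2: "?I 2 \<le> 3 * \<tau>\<^sup>2 * prob A"
    by (subst (asm) ennreal_le_iff) (simp_all del: ennreal_mult)
  have "ennreal (?I 4) \<le> ennreal 2 * ennreal (7 * \<tau> ^ 4 * exp (- \<tau>\<^sup>2 / 2))"
    using mult_left_mono[OF std_normal_tail_fourth_moment[OF \<tau>], of 2]
    by (subst nn) simp_all
  also have "\<dots> = ennreal (14 * \<tau> ^ 4 * exp (- \<tau>\<^sup>2 / 2))"
    by (subst ennreal_mult[symmetric]) simp_all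
  finally have I4: "?I 4 \<le> 14 * \<tau> ^ 4 * exp (- \<tau>\<^sup>2 / 2)"
    by (subst (asm) ennreal_le_iff) simp_all
  \<comment> \<open>The density is positive everywhere, so a null event would be Lebesgue null; but
    \<open>A\<close> contains an interval of length one.\<close>
  have pos: "0 < prob A"
  proof (rule ccontr)
    assume "\<not> 0 < prob A"
    then have "emeasure std_normal A = 0"
      by (simp add: emeasure_eq_measure zero_less_measure_iff measure_le_0_iff)
    then have "AE x in std_normal. x \<notin> A"
      by (intro AE_not_in) (auto simp: null_sets_def)
    then have "AE x in lborel. x \<notin> A"
      by (subst (asm) AE_density) (auto simp: normal_density_pos less_top)
    then have "emeasure lborel A = 0"
      by (subst (asm) AE_iff_null_sets[symmetric]) auto
    moreover have "{\<tau><..<\<tau>+1} \<subseteq> A"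
      using \<tau> by (auto simp: A_def intro!: power_strict_mono)
    then have "emeasure lborel {\<tau><..<\<tau>+1} \<le> emeasure lborel A"
      by (intro emeasure_mono) auto
    ultimately show False
      by simp
  qed
  \<comment> \<open>Conditioning on \<open>A\<close> is reweighting by
    \<open>indicator A x / prob A\<close>, which turns \<alpha> into a ratio of integrals under
    \<open>std_normal\<close>.\<close>
  have "\<alpha> = (\<integral>x. indicator A x / prob A * x\<^sup>2 \<partial>std_normal)"
  proof -
    have "uniform_measure std_normal A = density std_normal (\<lambda>x. ennreal (indicator A x / prob A))"
      unfolding uniform_measure_def emeasure_eq_measure
      using pos by (intro density_cong AE_I2) (auto simp: divide_ennreal[symmetric] ennreal_indicator[symmetric] simp del: ennreal_indicator split: split_indicator)
    then show ?thesis
      unfolding \<alpha>_def by (simp only:) (subst integral_density, use pos in auto)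
  qed
  also have "\<dots> = ?I 2 / prob A"
    by (subst Bochner_Integration.integral_divide_zero[symmetric]) (auto intro!: Bochner_Integration.integral_cong simp: ac_simps)
  finally have \<alpha>: "\<alpha> = ?I 2 / prob A" .
  show \<alpha>0: "0 \<le> \<alpha>"
    unfolding \<alpha> using nonneg[of 2] pos by simp
  show \<alpha>_le: "\<alpha> \<le> 3 * \<tau>\<^sup>2"
    unfolding \<alpha> using I2 pos by (simp add: divide_le_eq)
  have eq1: "(x\<^sup>2 - \<alpha>) * indicator A x = x\<^sup>2 * indicator A x - \<alpha> * (x ^ 0 * indicator A x)" for x
    by (simp add: algebra_simps)
  show "integrable std_normal (\<lambda>x. (x\<^sup>2 - \<alpha>) * indicator A x)"
    unfolding eq1 using int[of 0] int[of 2] by (intro Bochner_Integration.integrable_diff integrable_mult_right) auto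
  have "(\<integral>x. (x\<^sup>2 - \<alpha>) * indicator A x \<partial>std_normal) = ?I 2 - (\<integral>x. \<alpha> * (x ^ 0 * indicator A x) \<partial>std_normal)"
    unfolding eq1 using int[of 0] int[of 2] by (intro Bochner_Integration.integral_diff integrable_mult_right) auto
  also have "(\<integral>x. \<alpha> * (x ^ 0 * indicator A x) \<partial>std_normal) = \<alpha> * ?I 0"
    by (rule integral_mult_right_zero)
  also have "?I 2 - \<alpha> * ?I 0 = 0"
    unfolding I0 \<alpha> using pos by simp
  finally show "(\<integral>x. (x\<^sup>2 - \<alpha>) * indicator A x \<partial>std_normal) = 0" .
  \<comment> \<open>On \<open>A\<close> the bound on \<alpha> gives \<alpha> \<le> 3 x^2, hence the
    constant 2 + 2 * 9 = 20. With the factor 14 of the fourth moment this becomes 280.\<close>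
  have le: "((x\<^sup>2 - \<alpha>) * indicator A x)\<^sup>2 \<le> 20 * (x ^ 4 * indicator A x)" for x
  proof (cases "x \<in> A")
    case True
    then have "\<tau>\<^sup>2 \<le> x\<^sup>2"
      by (simp add: A_def)
    then have "\<alpha> \<le> 3 * x\<^sup>2"
      using \<alpha>_le by simp
    then have "\<alpha>\<^sup>2 \<le> (3 * x\<^sup>2)\<^sup>2"
      using \<alpha>0 by (intro power_mono)
    moreover have "(x\<^sup>2 - \<alpha>)\<^sup>2 \<le> 2 * (x\<^sup>2)\<^sup>2 + 2 * \<alpha>\<^sup>2"
      using zero_le_power2[of "x\<^sup>2 + \<alpha>"] by (simp add: power2_sum power2_diff)
    ultimately show ?thesis
      using True by (simp add: power_mult_distrib)
  qed simp
  show int2: "integrable std_normal (\<lambda>x. ((x\<^sup>2 - \<alpha>) * indicator A x)\<^sup>2)"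
    by (rule Bochner_Integration.integrable_bound[OF integrable_mult_right[OF int[of 4], of 20]])
      (use le in \<open>auto intro!: AE_I2 simp: abs_of_nonneg\<close>)
  have "(\<integral>x. ((x\<^sup>2 - \<alpha>) * indicator A x)\<^sup>2 \<partial>std_normal) \<le> (\<integral>x. 20 * (x ^ 4 * indicator A x) \<partial>std_normal)"
    using int by (intro integral_mono int2 le) auto
  also have "\<dots> = 20 * ?I 4"
    by (rule integral_mult_right_zero)
  also have "\<dots> \<le> 280 * \<tau> ^ 4 * exp (- \<tau>\<^sup>2 / 2)"
    using I4 by simp
  finally show "(\<integral>x. ((x\<^sup>2 - \<alpha>) * indicator A x)\<^sup>2 \<partial>std_normal) \<le> 280 * \<tau> ^ 4 * exp (- \<tau>\<^sup>2 / 2)" .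
qed

section \<open>Second moments of sums of independent centred variables\<close>

text \<open>After expanding the square, a mixed term factorises over the product measure and
  vanishes because one factor has mean zero; the diagonal terms remain.\<close>

lemma nn_integral_PiM_square_sum:
  fixes M :: "'a measure" and f :: "'i \<Rightarrow> 'a \<Rightarrow> real"
  assumes "prob_space M" and [simp]: "finite I"
    and int: "\<And>i. i \<in> I \<Longrightarrow> integrable M (f i)"
    and int2: "\<And>i. i \<in> I \<Longrightarrow> integrable M (\<lambda>x. (f i x)\<^sup>2)"
    and mean: "\<And>i. i \<in> I \<Longrightarrow> (\<integral>x. f i x \<partial>M) = 0"
  shows "(\<integral>\<^sup>+x. ennreal ((\<Sum>i\<in>I. f i (x i))\<^sup>2) \<partial>PiM I (\<lambda>_. M)) = ennreal (\<Sum>i\<in>I. \<integral>x. (f i x)\<^sup>2 \<partial>M)"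
proof -
  interpret M: prob_space M by fact
  interpret product_sigma_finite "\<lambda>_. M" ..
  let ?P = "PiM I (\<lambda>_. M)"
  \<comment> \<open>\<open>g i j k\<close> is the factor of the (i, j) term that depends on
    coordinate \<open>k\<close>. Both factors fall on the same coordinate when i = j, so the product
    rules cover diagonal and mixed terms together.\<close>
  define g where "g i j k x = (if k = i then f i x else 1) * (if k = j then f j x else 1)" for i j k x
  have g_int: "integrable M (g i j k)" if "i \<in> I" "j \<in> I" for i j k
    using int[OF that(1)] int[OF that(2)] int2[OF that(1)]
    by (cases "k = i"; cases "k = j") (auto simp: g_def[abs_def] power2_eq_square)
  have g_prod: "(\<Prod>k\<in>I. g i j k (x k)) = f i (x i) * f j (x j)" if "i \<in> I" "j \<in> I" for i j x
    using that by (simp add: g_def prod.distrib)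
  have pair_int: "integrable ?P (\<lambda>x. f i (x i) * f j (x j))" if "i \<in> I" "j \<in> I" for i j
    using product_integrable_prod[of I "g i j"] g_int[OF that] by (simp add: g_prod that)
  have pair: "(\<integral>x. f i (x i) * f j (x j) \<partial>?P) = (if i = j then \<integral>x. (f i x)\<^sup>2 \<partial>M else 0)"
    if "i \<in> I" "j \<in> I" for i j
  proof -
    have "(\<integral>x. f i (x i) * f j (x j) \<partial>?P) = (\<Prod>k\<in>I. \<integral>x. g i j k x \<partial>M)"
      using product_integral_prod[of I "g i j"] g_int[OF that] by (simp add: g_prod that)
    also have "\<dots> = (if i = j then \<integral>x. (f i x)\<^sup>2 \<partial>M else 0)"
    proof (cases "i = j")
      case True
      have "(\<Prod>k\<in>I. \<integral>x. g i j k x \<partial>M) = (\<Prod>k\<in>I. if k = i then \<integral>x. (f i x)\<^sup>2 \<partial>M else 1)"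
        by (intro prod.cong) (auto simp: g_def True power2_eq_square M.prob_space)
      then show ?thesis
        using that True by (simp add: prod.delta')
    next
      case False
      then have "(\<integral>x. g i j i x \<partial>M) = 0"
        using mean[OF that(1)] by (simp add: g_def)
      then have "(\<Prod>k\<in>I. \<integral>x. g i j k x \<partial>M) = 0"
        using that(1) by (intro prod_zero) auto
      then show ?thesis
        using False by simp
    qed
    finally show ?thesis .
  qed
  have eq: "(\<Sum>i\<in>I. f i (x i))\<^sup>2 = (\<Sum>i\<in>I. \<Sum>j\<in>I. f i (x i) * f j (x j))" for x
    by (simp add: power2_eq_square sum_product)
  have "(\<integral>\<^sup>+x. ennreal ((\<Sum>i\<in>I. f i (x i))\<^sup>2) \<partial>?P) = ennreal (\<integral>x. (\<Sum>i\<in>I. f i (x i))\<^sup>2 \<partial>?P)"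
  proof (rule nn_integral_eq_integral)
    show "integrable ?P (\<lambda>x. (\<Sum>i\<in>I. f i (x i))\<^sup>2)"
      unfolding eq using pair_int by auto
  qed auto
  also have "(\<integral>x. (\<Sum>i\<in>I. f i (x i))\<^sup>2 \<partial>?P) = (\<Sum>i\<in>I. \<integral>x. (f i x)\<^sup>2 \<partial>M)"
    unfolding eq using pair_int pair by (simp add: Bochner_Integration.integral_sum)
  finally show ?thesis .
qed

section \<open>Upper bound\<close>

text \<open>From |R - N| (R + N) = |R^2 - N^2| follow both (R - N)^2 \<le> v and (R - N)^2 N^2 \<le>
  v^2, where v is the error of \<open>Q\<close>. They are merged into one inequality that is linear
  in v^2, so that it can be integrated using the second moment only.\<close>

lemma sqrt_estimator_sq_error:
  fixes Q N B :: real
  assumes N: "0 \<le> N" and B: "0 < B"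
  shows "(sqrt (max Q 0) - N)\<^sup>2 \<le> 2 / (N\<^sup>2 + B) * (Q - N\<^sup>2)\<^sup>2 + B / 2"
proof -
  define R where "R = sqrt (max Q 0)"
  define u where "u = (R - N)\<^sup>2"
  define v where "v = \<bar>Q - N\<^sup>2\<bar>"
  have R: "0 \<le> R" "R\<^sup>2 = max Q 0"
    by (simp_all add: R_def)
  have v: "\<bar>R - N\<bar> * (R + N) \<le> v"
  proof -
    have "\<bar>R - N\<bar> * (R + N) = \<bar>(R - N) * (R + N)\<bar>"
      using R(1) N by (simp add: abs_mult)
    also have "(R - N) * (R + N) = R\<^sup>2 - N\<^sup>2"
      by (simp add: power2_eq_square algebra_simps)
    \<comment> \<open>Replacing a negative \<open>Q\<close> by 0 only moves it closer to the
      nonnegative target N^2.\<close>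
    also have "\<bar>R\<^sup>2 - N\<^sup>2\<bar> \<le> v"
      unfolding R v_def max_def by (smt (verit) zero_le_power2)
    finally show ?thesis .
  qed
  have v0: "0 \<le> v"
    by (simp add: v_def)
  have u_le: "u \<le> v"
  proof -
    have "u = \<bar>R - N\<bar> * \<bar>R - N\<bar>"
      by (simp add: u_def power2_eq_square)
    also have "\<dots> \<le> \<bar>R - N\<bar> * (R + N)"
      using R N by (intro mult_left_mono) auto
    finally show ?thesis
      using v by simp
  qed
  have u_le2: "u * N\<^sup>2 \<le> v\<^sup>2"
  proof -
    have "u * N\<^sup>2 = (\<bar>R - N\<bar> * N)\<^sup>2"
      by (simp add: u_def power_mult_distrib)
    also have "\<dots> \<le> v\<^sup>2"
      using N R by (intro power_mono order_trans[OF _ v] mult_left_mono) auto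
    finally show ?thesis .
  qed
  \<comment> \<open>For B \<le> N^2 the second bound is the good one, with N^2 + B \<le> 2 N^2.
    Otherwise the first bound is made quadratic by v \<le> v^2 / (2 B) + B / 2.\<close>
  have "u \<le> 2 / (N\<^sup>2 + B) * v\<^sup>2 + B / 2"
  proof (cases "B \<le> N\<^sup>2")
    case True
    then have "u * (N\<^sup>2 + B) \<le> u * (2 * N\<^sup>2)"
      by (intro mult_left_mono) (auto simp: u_def)
    then have "u * (N\<^sup>2 + B) \<le> 2 * v\<^sup>2"
      using u_le2 by simp
    then have "u \<le> 2 * v\<^sup>2 / (N\<^sup>2 + B)"
      using B True by (simp add: pos_le_divide_eq)
    then show ?thesis
      using B by simp
  next
    case False
    have "v \<le> v\<^sup>2 / (2 * B) + B / 2"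
      using B zero_le_power2[of "v - B"] by (simp add: field_simps power2_eq_square)
    with u_le have "u \<le> v\<^sup>2 / (2 * B) + B / 2"
      by simp
    also have "v\<^sup>2 / (2 * B) = 2 * (v\<^sup>2 / (4 * B))"
      by simp
    also have "\<dots> \<le> 2 * (v\<^sup>2 / (N\<^sup>2 + B))"
      using False B by (intro mult_left_mono divide_left_mono) (auto intro!: mult_pos_pos add_nonneg_pos)
    finally show ?thesis
      by simp
  qed
  then show ?thesis
    by (simp add: u_def v_def R_def)
qed

text \<open>The part of the second moment that grows with N^2 is cancelled by the denominator N^2 +
  B, since N^2 + B^2 \<le> B (N^2 + B) for \<open>1 \<le> B\<close>. This makes the final bound
  uniform in the signal.\<close>

lemma nn_integral_sqrt_estimator:
  fixes Q :: "'a \<Rightarrow> real" and N B K :: real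
  assumes "prob_space M" and Q[measurable]: "Q \<in> borel_measurable M"
    and N: "0 \<le> N" and B: "1 \<le> B" and K: "0 \<le> K"
    and second: "(\<integral>\<^sup>+x. ennreal ((Q x - N\<^sup>2)\<^sup>2) \<partial>M) \<le> ennreal (K * (N\<^sup>2 + B\<^sup>2))"
  shows "(\<integral>\<^sup>+x. ennreal ((sqrt (max (Q x) 0) - N)\<^sup>2) \<partial>M) \<le> ennreal ((2 * K + 1) * B)"
proof -
  interpret prob_space M by fact
  let ?c = "2 / (N\<^sup>2 + B)"
  have pos: "0 < N\<^sup>2 + B"
    using B by (intro add_nonneg_pos) auto
  have "(\<integral>\<^sup>+x. ennreal ((sqrt (max (Q x) 0) - N)\<^sup>2) \<partial>M)
      \<le> (\<integral>\<^sup>+x. ennreal ?c * ennreal ((Q x - N\<^sup>2)\<^sup>2) + ennreal (B / 2) \<partial>M)"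
    using sqrt_estimator_sq_error[OF N, of B] B pos
    by (intro nn_integral_mono) (simp add: ennreal_mult[symmetric] ennreal_plus[symmetric] del: ennreal_plus)
  also have "\<dots> = ennreal ?c * (\<integral>\<^sup>+x. ennreal ((Q x - N\<^sup>2)\<^sup>2) \<partial>M) + ennreal (B / 2)"
    by (simp add: nn_integral_add nn_integral_cmult emeasure_space_1)
  also have "\<dots> \<le> ennreal ?c * ennreal (K * (N\<^sup>2 + B\<^sup>2)) + ennreal (B / 2)"
    by (intro add_mono mult_left_mono second) auto
  also have "\<dots> = ennreal (?c * (K * (N\<^sup>2 + B\<^sup>2)) + B / 2)"
    using B pos K by (simp add: ennreal_mult[symmetric] ennreal_plus[symmetric] del: ennreal_plus)
  also have "\<dots> \<le> ennreal ((2 * K + 1) * B)"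
  proof (rule ennreal_leI)
    have "N\<^sup>2 * 1 \<le> N\<^sup>2 * B"
      using B by (intro mult_left_mono) auto
    then have "N\<^sup>2 + B\<^sup>2 \<le> B * (N\<^sup>2 + B)"
      by (simp add: power2_eq_square algebra_simps)
    then have "?c * (K * (N\<^sup>2 + B\<^sup>2)) \<le> ?c * (K * (B * (N\<^sup>2 + B)))"
      using pos K by (intro mult_left_mono) auto
    also have "\<dots> = 2 * K * B"
      using pos by simp
    finally show "?c * (K * (N\<^sup>2 + B\<^sup>2)) + B / 2 \<le> (2 * K + 1) * B"
      using B by (simp add: algebra_simps)
  qed
  finally show ?thesis .
qed

lemma power2_sum_four_le:
  fixes a b c e :: real
  shows "(a + b + c + e)\<^sup>2 \<le> 4 * (a\<^sup>2 + b\<^sup>2 + c\<^sup>2 + e\<^sup>2)"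
proof -
  have "4 * (a\<^sup>2 + b\<^sup>2 + c\<^sup>2 + e\<^sup>2) - (a + b + c + e)\<^sup>2
      = (a - b)\<^sup>2 + (a - c)\<^sup>2 + (a - e)\<^sup>2 + (b - c)\<^sup>2 + (b - e)\<^sup>2 + (c - e)\<^sup>2"
    by (simp add: power2_eq_square algebra_simps)
  then show ?thesis
    by (smt (verit) zero_le_power2)
qed

section \<open>Noise terms and reduction to unit variance\<close>

lemma prob_space_noise_law: "prob_space (noise_law d)"
  unfolding noise_law_def by (intro prob_space_PiM prob_space_std_normal)

lemma l2_norm_square: "(l2_norm d a)\<^sup>2 = (\<Sum>j<d. (a j)\<^sup>2)"
  by (simp add: l2_norm_def L2_set_def sum_nonneg)

lemma l2_norm_nonneg: "0 \<le> l2_norm d a"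
  by (simp add: l2_norm_def)

lemma nn_integral_noise_square_sum:
  assumes "\<And>j. j < d \<Longrightarrow> integrable std_normal (f j)"
    and "\<And>j. j < d \<Longrightarrow> integrable std_normal (\<lambda>x. (f j x)\<^sup>2)"
    and "\<And>j. j < d \<Longrightarrow> (\<integral>x. f j x \<partial>std_normal) = 0"
  shows "(\<integral>\<^sup>+\<xi>. ennreal ((\<Sum>j<d. f j (\<xi> j))\<^sup>2) \<partial>noise_law d) = ennreal (\<Sum>j<d. \<integral>x. (f j x)\<^sup>2 \<partial>std_normal)"
  unfolding noise_law_def using assms prob_space_std_normal by (intro nn_integral_PiM_square_sum) auto

lemma nn_integral_noise_linear:
  "(\<integral>\<^sup>+\<xi>. ennreal ((\<Sum>j<d. 2 * a j * \<xi> j)\<^sup>2) \<partial>noise_law d) = ennreal (4 * (l2_norm d a)\<^sup>2)"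
proof -
  have "(\<integral>\<^sup>+\<xi>. ennreal ((\<Sum>j<d. 2 * a j * \<xi> j)\<^sup>2) \<partial>noise_law d)
      = ennreal (\<Sum>j<d. \<integral>x. (2 * a j * x)\<^sup>2 \<partial>std_normal)"
    using integrable_std_normal_power[of 1] integrable_std_normal_power[of 2]
    by (intro nn_integral_noise_square_sum) (auto simp: power_mult_distrib std_normal_moments)
  also have "(\<Sum>j<d. \<integral>x. (2 * a j * x)\<^sup>2 \<partial>std_normal) = 4 * (l2_norm d a)\<^sup>2"
    by (simp add: power_mult_distrib std_normal_moments l2_norm_square sum_distrib_left)
  finally show ?thesis .
qed

text \<open>Used with \<open>S\<close> the support of the signal in the sparse regime and with all
  coordinates in the dense one. Zero summands off \<open>S\<close> keep the sum in the form required
  by \<open>nn_integral_noise_square_sum\<close>.\<close>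

lemma nn_integral_noise_centered_squares:
  assumes "S \<subseteq> {..<d}"
  shows "(\<integral>\<^sup>+\<xi>. ennreal ((\<Sum>j<d. if j \<in> S then (\<xi> j)\<^sup>2 - 1 else 0)\<^sup>2) \<partial>noise_law d) = ennreal (2 * real (card S))"
proof -
  have "(\<integral>\<^sup>+\<xi>. ennreal ((\<Sum>j<d. if j \<in> S then (\<xi> j)\<^sup>2 - 1 else 0)\<^sup>2) \<partial>noise_law d)
      = ennreal (\<Sum>j<d. \<integral>x. (if j \<in> S then x\<^sup>2 - 1 else 0)\<^sup>2 \<partial>std_normal)"
  proof (rule nn_integral_noise_square_sum)
    fix j
    show "integrable std_normal (\<lambda>x. if j \<in> S then x\<^sup>2 - 1 else 0)"
      "integrable std_normal (\<lambda>x. (if j \<in> S then x\<^sup>2 - 1 else 0)\<^sup>2)"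
      "(\<integral>x. (if j \<in> S then x\<^sup>2 - 1 else 0) \<partial>std_normal) = 0"
      using std_normal_centered_square by (cases "j \<in> S"; simp)+
  qed
  also have "(\<Sum>j<d. \<integral>x. (if j \<in> S then x\<^sup>2 - 1 else 0)\<^sup>2 \<partial>std_normal) = (\<Sum>j<d. if j \<in> S then 2 else 0)"
    using std_normal_centered_square by (intro sum.cong) auto
  also have "\<dots> = 2 * real (card S)"
    using assms by (simp add: sum.If_cases Int_absorb1)
  finally show ?thesis .
qed

lemma Q_hat_scale:
  assumes "0 < \<sigma>"
  shows "Q_hat \<sigma> s d (\<lambda>j\<in>{..<d}. \<sigma> * z j) = \<sigma>\<^sup>2 * Q_hat 1 s d z"
proof -
  have ind: "indicator {t. \<sigma> * c < \<bar>t\<bar>} (\<sigma> * x) = (indicator {t. c < \<bar>t\<bar>} x :: real)" for c x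
    using assms by (simp add: indicator_def abs_mult)
  show ?thesis
    by (auto simp: Q_hat_def ind sum_distrib_left power_mult_distrib algebra_simps intro!: sum.cong)
qed

text \<open>The observation is \<sigma> times a unit-variance observation of \<theta>/\<sigma>. The
  threshold scales along, so \<open>Q_hat\<close> is homogeneous of degree 2 and the squared error
  of its root picks up the factor \<sigma>^2.\<close>

lemma norm_risk_N_hat_scale:
  assumes \<sigma>: "0 < \<sigma>"
  shows "norm_risk d \<sigma> (N_hat \<sigma> s d) \<theta> =
    ennreal (\<sigma>\<^sup>2) * (\<integral>\<^sup>+\<xi>. ennreal ((sqrt (max (Q_hat 1 s d (\<lambda>j. \<theta> j / \<sigma> + \<xi> j)) 0)
      - l2_norm d (\<lambda>j. \<theta> j / \<sigma>))\<^sup>2) \<partial>noise_law d)"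
proof -
  have [measurable]: "N_hat \<sigma> s d \<in> borel_measurable (obs_space d)"
    using N_hat_in_estimators by (simp add: estimators_def)
  have shift[measurable]: "(\<lambda>\<xi>. \<lambda>j\<in>{..<d}. \<theta> j + \<sigma> * \<xi> j) \<in> measurable (noise_law d) (obs_space d)"
    unfolding noise_law_def obs_space_def by measurable
  have norm: "l2_norm d \<theta> = \<sigma> * l2_norm d (\<lambda>j. \<theta> j / \<sigma>)"
    using L2_set_right_distrib[of \<sigma> "\<lambda>j. \<theta> j / \<sigma>" "{..<d}"] \<sigma> by (simp add: l2_norm_def)
  have est: "N_hat \<sigma> s d (\<lambda>j\<in>{..<d}. \<theta> j + \<sigma> * \<xi> j)
      = \<sigma> * sqrt (max (Q_hat 1 s d (\<lambda>j. \<theta> j / \<sigma> + \<xi> j)) 0)" for \<xi>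
  proof -
    have "(\<lambda>j\<in>{..<d}. \<theta> j + \<sigma> * \<xi> j) = (\<lambda>j\<in>{..<d}. \<sigma> * (\<theta> j / \<sigma> + \<xi> j))"
      using \<sigma> by (auto simp: restrict_def algebra_simps)
    then have "Q_hat \<sigma> s d (\<lambda>j\<in>{..<d}. \<theta> j + \<sigma> * \<xi> j) = \<sigma>\<^sup>2 * Q_hat 1 s d (\<lambda>j. \<theta> j / \<sigma> + \<xi> j)"
      using Q_hat_scale[OF \<sigma>] by simp
    moreover have "max (\<sigma>\<^sup>2 * q) 0 = \<sigma>\<^sup>2 * max q 0" for q
      by (simp add: max_mult_distrib_left)
    ultimately show ?thesis
      using \<sigma> by (simp add: N_hat_def real_sqrt_mult)
  qed
  have "norm_risk d \<sigma> (N_hat \<sigma> s d) \<theta>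
      = (\<integral>\<^sup>+\<xi>. ennreal ((N_hat \<sigma> s d (\<lambda>j\<in>{..<d}. \<theta> j + \<sigma> * \<xi> j) - l2_norm d \<theta>)\<^sup>2) \<partial>noise_law d)"
    unfolding norm_risk_def obs_law_def by (rule nn_integral_distr) auto
  also have "\<dots> = (\<integral>\<^sup>+\<xi>. ennreal (\<sigma>\<^sup>2) * ennreal ((sqrt (max (Q_hat 1 s d (\<lambda>j. \<theta> j / \<sigma> + \<xi> j)) 0)
      - l2_norm d (\<lambda>j. \<theta> j / \<sigma>))\<^sup>2) \<partial>noise_law d)"
    unfolding est norm by (simp add: ennreal_mult[symmetric] power_mult_distrib right_diff_distrib[symmetric])
  also have "\<dots> = ennreal (\<sigma>\<^sup>2) * (\<integral>\<^sup>+\<xi>. ennreal ((sqrt (max (Q_hat 1 s d (\<lambda>j. \<theta> j / \<sigma> + \<xi> j)) 0)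
      - l2_norm d (\<lambda>j. \<theta> j / \<sigma>))\<^sup>2) \<partial>noise_law d)"
    unfolding Q_hat_def noise_law_def by (rule nn_integral_cmult) measurable
  finally show ?thesis .
qed

section \<open>Second moment of the error of \<open>Q_hat\<close>\<close>

lemma Q_hat_shift_measurable [measurable]:
  "(\<lambda>\<xi>. Q_hat \<sigma> s d (\<lambda>j. a j + \<xi> j)) \<in> borel_measurable (noise_law d)"
  unfolding Q_hat_def noise_law_def by measurable

text \<open>Without thresholding the error is exactly the cross term plus the centred noise squares,
  with second moments 4 N^2 and 2 d, where N is the norm of \<open>a\<close>.\<close>

lemma Q_hat_second_moment_dense:
  assumes "sqrt (real d) \<le> real s"
  shows "(\<integral>\<^sup>+\<xi>. ennreal ((Q_hat 1 s d (\<lambda>j. a j + \<xi> j) - (l2_norm d a)\<^sup>2)\<^sup>2) \<partial>noise_law d)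
    \<le> ennreal (8 * ((l2_norm d a)\<^sup>2 + (sqrt (real d))\<^sup>2))"
proof -
  define S where "S = {..<d}"
  have S: "S \<subseteq> {..<d}" "card S = d"
    by (simp_all add: S_def)
  let ?Z = "\<lambda>\<xi>. \<Sum>j<d. 2 * a j * \<xi> j" and ?W = "\<lambda>\<xi>::nat \<Rightarrow> real. \<Sum>j<d. if j \<in> S then (\<xi> j)\<^sup>2 - 1 else 0"
  have [measurable]: "?Z \<in> borel_measurable (noise_law d)" "?W \<in> borel_measurable (noise_law d)"
    unfolding noise_law_def by measurable
  have eq: "Q_hat 1 s d (\<lambda>j. a j + \<xi> j) - (l2_norm d a)\<^sup>2 = ?Z \<xi> + ?W \<xi>" for \<xi>
  proof -
    have "?W \<xi> = (\<Sum>j<d. (\<xi> j)\<^sup>2 - 1)"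
      by (rule sum.cong) (auto simp: S_def)
    also have "\<dots> = (\<Sum>j<d. (\<xi> j)\<^sup>2) - real d"
      by (simp add: sum_subtractf)
    finally show ?thesis
      using assms by (simp add: Q_hat_def l2_norm_square power2_sum sum.distrib algebra_simps)
  qed
  have "(\<integral>\<^sup>+\<xi>. ennreal ((Q_hat 1 s d (\<lambda>j. a j + \<xi> j) - (l2_norm d a)\<^sup>2)\<^sup>2) \<partial>noise_law d)
      \<le> (\<integral>\<^sup>+\<xi>. ennreal 2 * (ennreal ((?Z \<xi>)\<^sup>2) + ennreal ((?W \<xi>)\<^sup>2)) \<partial>noise_law d)"
  proof (rule nn_integral_mono)
    fix \<xi>
    have "(?Z \<xi> + ?W \<xi>)\<^sup>2 \<le> 2 * ((?Z \<xi>)\<^sup>2 + (?W \<xi>)\<^sup>2)"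
      using zero_le_power2[of "?Z \<xi> - ?W \<xi>"] by (simp add: power2_sum power2_diff)
    then have "ennreal ((?Z \<xi> + ?W \<xi>)\<^sup>2) \<le> ennreal (2 * ((?Z \<xi>)\<^sup>2 + (?W \<xi>)\<^sup>2))"
      by (rule ennreal_leI)
    then show "ennreal ((Q_hat 1 s d (\<lambda>j. a j + \<xi> j) - (l2_norm d a)\<^sup>2)\<^sup>2)
        \<le> ennreal 2 * (ennreal ((?Z \<xi>)\<^sup>2) + ennreal ((?W \<xi>)\<^sup>2))"
      by (simp only: eq ennreal_mult ennreal_plus zero_le_power2 add_nonneg_nonneg zero_le_numeral)
  qed
  also have "\<dots> = ennreal 2 * ((\<integral>\<^sup>+\<xi>. ennreal ((?Z \<xi>)\<^sup>2) \<partial>noise_law d) + (\<integral>\<^sup>+\<xi>. ennreal ((?W \<xi>)\<^sup>2) \<partial>noise_law d))"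
    by (subst nn_integral_cmult, measurable, subst nn_integral_add) auto
  also have "\<dots> = ennreal 2 * (ennreal (4 * (l2_norm d a)\<^sup>2) + ennreal (2 * real d))"
    by (simp only: nn_integral_noise_linear nn_integral_noise_centered_squares[OF S(1)] S(2))
  also have "\<dots> = ennreal (2 * (4 * (l2_norm d a)\<^sup>2 + 2 * real d))"
    by (subst ennreal_plus[symmetric], simp, simp, subst ennreal_mult[symmetric]) auto
  also have "\<dots> \<le> ennreal (8 * ((l2_norm d a)\<^sup>2 + (sqrt (real d))\<^sup>2))"
    by (intro ennreal_leI) simp
  finally show ?thesis .
qed

text \<open>The error is split as Z + W + V plus a remainder: the cross term, the centred squares on
  the support, the thresholded pure noise off the support, and the effect of thresholding on the
  support. Only Z depends on the size of the signal.\<close>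

lemma Q_hat_second_moment_sparse:
  fixes s d :: nat
  defines "\<tau> \<equiv> sqrt (2 * ln (1 + real d / (real s)\<^sup>2))"
  assumes s: "1 \<le> s" "real s < sqrt (real d)"
    and sparse: "l0_norm d a \<le> s"
  shows "1 \<le> \<tau>"
    and "(\<integral>\<^sup>+\<xi>. ennreal ((Q_hat 1 s d (\<lambda>j. a j + \<xi> j) - (l2_norm d a)\<^sup>2)\<^sup>2) \<partial>noise_law d)
    \<le> ennreal (1228 * ((l2_norm d a)\<^sup>2 + (real s * \<tau>\<^sup>2)\<^sup>2))"
proof -
  define L where "L = ln (1 + real d / (real s)\<^sup>2)"
  define S where "S = {j \<in> {..<d}. a j \<noteq> 0}"
  define A where "A = {x::real. \<tau>\<^sup>2 < x\<^sup>2}"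
  define \<alpha> where "\<alpha> = alpha d s"
  have sd: "(real s)\<^sup>2 < real d"
    using s real_less_rsqrt[of "real s"] by (metis of_nat_0_le_iff real_sqrt_less_iff real_sqrt_unique)
  have ratio: "1 < real d / (real s)\<^sup>2"
    using sd s by simp
  \<comment> \<open>Here sparsity below sqrt d enters: it makes d/s^2 exceed 1, hence \<tau> \<ge> 1
    as the tail bounds require.\<close>
  have "ln 2 \<le> L"
    unfolding L_def using ratio by (intro ln_mono) auto
  then have L: "1 / 2 \<le> L"
    using ln2_ge_two_thirds by simp
  have \<tau>2: "\<tau>\<^sup>2 = 2 * L"
    using L by (simp add: \<tau>_def L_def)
  show \<tau>: "1 \<le> \<tau>"
    using L unfolding \<tau>_def L_def by (intro real_le_rsqrt) simp
  have \<tau>2_ge: "1 \<le> \<tau>\<^sup>2"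
    using L \<tau>2 by simp
  \<comment> \<open>The threshold is calibrated so that this exponential is 1 / (1 + d/s^2); summed
    over up to d noise coordinates it leaves order s^2.\<close>
  have exp: "exp (- \<tau>\<^sup>2 / 2) \<le> (real s)\<^sup>2 / real d"
  proof -
    have "exp (- \<tau>\<^sup>2 / 2) = 1 / (1 + real d / (real s)\<^sup>2)"
      using ratio by (simp add: \<tau>2 L_def exp_minus inverse_eq_divide)
    also have "\<dots> \<le> 1 / (real d / (real s)\<^sup>2)"
      using ratio by (intro frac_le) auto
    finally show ?thesis
      by simp
  qed
  have \<alpha>_eq: "\<alpha> = (\<integral>x. x\<^sup>2 \<partial>uniform_measure std_normal A)"
    unfolding \<alpha>_def alpha_def A_def \<tau>2 L_def ..
  note tail = std_normal_tail_conditional[OF \<tau>, folded A_def, folded \<alpha>_eq]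
  have S: "S \<subseteq> {..<d}" "card S \<le> s" "finite S"
    using sparse by (auto simp: S_def l0_norm_def)
  let ?\<eta> = "\<lambda>x. (x\<^sup>2 - \<alpha>) * indicator A x"
  let ?Z = "\<lambda>\<xi>. \<Sum>j<d. 2 * a j * \<xi> j" and ?W = "\<lambda>\<xi>::nat \<Rightarrow> real. \<Sum>j<d. if j \<in> S then (\<xi> j)\<^sup>2 - 1 else 0"
  let ?V = "\<lambda>\<xi>::nat \<Rightarrow> real. \<Sum>j<d. if j \<in> S then 0 else ?\<eta> (\<xi> j)"
  let ?b = "5 * real s * \<tau>\<^sup>2"
  let ?D = "\<lambda>\<xi>. Q_hat 1 s d (\<lambda>j. a j + \<xi> j) - (l2_norm d a)\<^sup>2"
  have [measurable]: "A \<in> sets borel"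
    unfolding A_def by measurable
  have [measurable]: "?Z \<in> borel_measurable (noise_law d)" "?W \<in> borel_measurable (noise_law d)"
    "?V \<in> borel_measurable (noise_law d)"
    unfolding noise_law_def by measurable
  \<comment> \<open>This bound is deterministic: it holds for every noise vector, however large the
    signal.\<close>
  have remainder: "\<bar>?D \<xi> - (?Z \<xi> + ?W \<xi> + ?V \<xi>)\<bar> \<le> ?b" for \<xi>
  proof -
    define r where "r j = ?\<eta> (a j + \<xi> j) - (a j)\<^sup>2
      - (2 * a j * \<xi> j + (if j \<in> S then (\<xi> j)\<^sup>2 - 1 else 0) + (if j \<in> S then 0 else ?\<eta> (\<xi> j)))" for j
    have "Q_hat 1 s d (\<lambda>j. a j + \<xi> j) = (\<Sum>j<d. ?\<eta> (a j + \<xi> j))"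
    proof -
      have "{t. \<bar>t\<bar> > 1 * \<tau>} = A"
        using abs_le_square_iff[of _ \<tau>] \<tau> by (auto simp: A_def not_le[symmetric])
      then show ?thesis
        using s unfolding \<tau>_def by (simp add: Q_hat_def \<alpha>_def)
    qed
    then have "?D \<xi> - (?Z \<xi> + ?W \<xi> + ?V \<xi>) = (\<Sum>j<d. r j)"
      by (simp add: r_def l2_norm_square sum.distrib sum_subtractf)
    \<comment> \<open>Off \<open>S\<close> the observation is pure noise and \<open>?V\<close>
      already accounts for it exactly.\<close>
    also have "\<dots> = (\<Sum>j\<in>S. r j)"
      using S by (intro sum.mono_neutral_right) (auto simp: r_def S_def)
    also have "\<bar>\<dots>\<bar> \<le> (\<Sum>j\<in>S. 5 * \<tau>\<^sup>2)"
    proof (rule order_trans[OF sum_abs sum_mono])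
      fix j assume j: "j \<in> S"
      \<comment> \<open>On the support the signal enters only through the observation. A kept
        coordinate leaves 1 - \<alpha>, a discarded one leaves 1 minus a square of size at most
        \<tau>^2.\<close>
      have "r j = ?\<eta> (a j + \<xi> j) - (a j + \<xi> j)\<^sup>2 + 1"
        using j by (simp add: r_def power2_sum)
      then have "r j = (if a j + \<xi> j \<in> A then 1 - \<alpha> else 1 - (a j + \<xi> j)\<^sup>2)"
        by simp
      moreover have "(a j + \<xi> j)\<^sup>2 \<le> \<tau>\<^sup>2" if "a j + \<xi> j \<notin> A"
        using that by (simp add: A_def)
      ultimately show "\<bar>r j\<bar> \<le> 5 * \<tau>\<^sup>2"
        using tail(1,2) \<tau>2_ge zero_le_power2[of "a j + \<xi> j"] by (smt (verit))
    qed
    also have "\<dots> \<le> ?b"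
      using S by (simp add: mult_right_mono)
    finally show ?thesis .
  qed
  \<comment> \<open>Each of the d summands is at most 280 \<tau>^4 s^2 / d, so the dimension
    cancels.\<close>
  have V: "(\<integral>\<^sup>+\<xi>. ennreal ((?V \<xi>)\<^sup>2) \<partial>noise_law d) \<le> ennreal (280 * (real s * \<tau>\<^sup>2)\<^sup>2)"
  proof -
    have "(\<integral>\<^sup>+\<xi>. ennreal ((?V \<xi>)\<^sup>2) \<partial>noise_law d)
        = ennreal (\<Sum>j<d. \<integral>x. (if j \<in> S then 0 else ?\<eta> x)\<^sup>2 \<partial>std_normal)"
    proof (rule nn_integral_noise_square_sum)
      fix j
      show "integrable std_normal (\<lambda>x. if j \<in> S then 0 else ?\<eta> x)"
        "integrable std_normal (\<lambda>x. (if j \<in> S then 0 else ?\<eta> x)\<^sup>2)"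
        "(\<integral>x. (if j \<in> S then 0 else ?\<eta> x) \<partial>std_normal) = 0"
        using tail(3,4,5) by (cases "j \<in> S"; simp)+
    qed
    also have "\<dots> \<le> ennreal (\<Sum>j<d. 280 * \<tau> ^ 4 * ((real s)\<^sup>2 / real d))"
    proof (intro ennreal_leI sum_mono)
      fix j
      have "(\<integral>x. (if j \<in> S then 0 else ?\<eta> x)\<^sup>2 \<partial>std_normal) \<le> 280 * \<tau> ^ 4 * exp (- \<tau>\<^sup>2 / 2)"
        using tail(6) by (cases "j \<in> S") auto
      also have "\<dots> \<le> 280 * \<tau> ^ 4 * ((real s)\<^sup>2 / real d)"
        by (intro mult_left_mono exp) auto
      finally show "(\<integral>x. (if j \<in> S then 0 else ?\<eta> x)\<^sup>2 \<partial>std_normal) \<le> 280 * \<tau> ^ 4 * ((real s)\<^sup>2 / real d)" .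
    qed
    also have "(\<Sum>j<d. 280 * \<tau> ^ 4 * ((real s)\<^sup>2 / real d)) = 280 * (real s * \<tau>\<^sup>2)\<^sup>2"
      using sd zero_le_power2[of "real s"] by (simp add: power_mult_distrib)
    finally show ?thesis .
  qed
  have "(\<integral>\<^sup>+\<xi>. ennreal ((?D \<xi>)\<^sup>2) \<partial>noise_law d)
      \<le> (\<integral>\<^sup>+\<xi>. ennreal 4 * (ennreal ((?Z \<xi>)\<^sup>2) + ennreal ((?W \<xi>)\<^sup>2) + ennreal ((?V \<xi>)\<^sup>2) + ennreal (?b\<^sup>2)) \<partial>noise_law d)"
  proof (rule nn_integral_mono)
    fix \<xi>
    define e where "e = ?D \<xi> - (?Z \<xi> + ?W \<xi> + ?V \<xi>)"
    have "e\<^sup>2 \<le> ?b\<^sup>2"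
      using remainder[of \<xi>] by (intro abs_le_square_iff[THEN iffD1]) (simp add: e_def)
    then have "4 * ((?Z \<xi>)\<^sup>2 + (?W \<xi>)\<^sup>2 + (?V \<xi>)\<^sup>2 + e\<^sup>2) \<le> 4 * ((?Z \<xi>)\<^sup>2 + (?W \<xi>)\<^sup>2 + (?V \<xi>)\<^sup>2 + ?b\<^sup>2)"
      by (intro mult_left_mono add_left_mono) simp_all
    moreover have "?D \<xi> = ?Z \<xi> + ?W \<xi> + ?V \<xi> + e"
      by (simp add: e_def)
    ultimately have "(?D \<xi>)\<^sup>2 \<le> 4 * ((?Z \<xi>)\<^sup>2 + (?W \<xi>)\<^sup>2 + (?V \<xi>)\<^sup>2 + ?b\<^sup>2)"
      using order_trans[OF power2_sum_four_le[of "?Z \<xi>" "?W \<xi>" "?V \<xi>" e]] by (simp only:)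
    then have "ennreal ((?D \<xi>)\<^sup>2) \<le> ennreal (4 * ((?Z \<xi>)\<^sup>2 + (?W \<xi>)\<^sup>2 + (?V \<xi>)\<^sup>2 + ?b\<^sup>2))"
      by (rule ennreal_leI)
    also have "\<dots> = ennreal 4 * (ennreal ((?Z \<xi>)\<^sup>2) + ennreal ((?W \<xi>)\<^sup>2) + ennreal ((?V \<xi>)\<^sup>2) + ennreal (?b\<^sup>2))"
      by (simp only: ennreal_mult ennreal_plus zero_le_power2 add_nonneg_nonneg zero_le_numeral)
    finally show "ennreal ((?D \<xi>)\<^sup>2)
      \<le> ennreal 4 * (ennreal ((?Z \<xi>)\<^sup>2) + ennreal ((?W \<xi>)\<^sup>2) + ennreal ((?V \<xi>)\<^sup>2) + ennreal (?b\<^sup>2))" .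
  qed
  also have "\<dots> = ennreal 4 * ((\<integral>\<^sup>+\<xi>. ennreal ((?Z \<xi>)\<^sup>2) \<partial>noise_law d) + (\<integral>\<^sup>+\<xi>. ennreal ((?W \<xi>)\<^sup>2) \<partial>noise_law d)
      + (\<integral>\<^sup>+\<xi>. ennreal ((?V \<xi>)\<^sup>2) \<partial>noise_law d) + ennreal (?b\<^sup>2))"
    using prob_space.emeasure_space_1[OF prob_space_noise_law, of d]
    by (subst nn_integral_cmult, measurable, subst nn_integral_add, measurable, subst nn_integral_add,
        measurable, subst nn_integral_add) auto
  also have "\<dots> \<le> ennreal 4 * (ennreal (4 * (l2_norm d a)\<^sup>2) + ennreal (2 * real (card S))
      + ennreal (280 * (real s * \<tau>\<^sup>2)\<^sup>2) + ennreal (?b\<^sup>2))"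
    unfolding nn_integral_noise_linear nn_integral_noise_centered_squares[OF S(1)]
    by (intro mult_left_mono add_mono V order_refl) auto
  also have "\<dots> = ennreal (4 * (4 * (l2_norm d a)\<^sup>2 + 2 * real (card S) + 280 * (real s * \<tau>\<^sup>2)\<^sup>2 + ?b\<^sup>2))"
    by (simp only: ennreal_mult ennreal_plus zero_le_power2 add_nonneg_nonneg zero_le_numeral
        mult_nonneg_nonneg of_nat_0_le_iff)
  also have "\<dots> \<le> ennreal (1228 * ((l2_norm d a)\<^sup>2 + (real s * \<tau>\<^sup>2)\<^sup>2))"
  proof (rule ennreal_leI)
    have "real s * 1 \<le> real s * \<tau>\<^sup>2"
      using \<tau>2_ge by (intro mult_left_mono) auto
    moreover have "1 \<le> real s"
      using s by simp
    ultimately have "real s \<le> (real s * \<tau>\<^sup>2)\<^sup>2"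
      using self_le_power[of "real s * \<tau>\<^sup>2" 2] by linarith
    then have card_le: "real (card S) \<le> (real s * \<tau>\<^sup>2)\<^sup>2"
      using S(2) by linarith
    have b: "?b\<^sup>2 = 25 * (real s * \<tau>\<^sup>2)\<^sup>2"
      by (simp add: power_mult_distrib)
    \<comment> \<open>The constant 1228 is 4 (2 + 280 + 25), after \<open>card S\<close> has been
      absorbed into the square of the rate.\<close>
    have "4 * (4 * x + 2 * y + 280 * z + 25 * z) \<le> 1228 * (x + z)" if "y \<le> z" "0 \<le> x" for x y z :: real
      using that by simp
    from this[OF card_le zero_le_power2] show "4 * (4 * (l2_norm d a)\<^sup>2 + 2 * real (card S) + 280 * (real s * \<tau>\<^sup>2)\<^sup>2 + ?b\<^sup>2)
        \<le> 1228 * ((l2_norm d a)\<^sup>2 + (real s * \<tau>\<^sup>2)\<^sup>2)"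
      unfolding b .
  qed
  finally show "(\<integral>\<^sup>+\<xi>. ennreal ((?D \<xi>)\<^sup>2) \<partial>noise_law d)
    \<le> ennreal (1228 * ((l2_norm d a)\<^sup>2 + (real s * \<tau>\<^sup>2)\<^sup>2))" .
qed

text \<open>In the sparse regime \<open>nn_integral_sqrt_estimator\<close> is applied with B = s
  \<tau>^2 and K = 1228; since \<tau>^2 is twice the logarithm, the constant is 2 (2 * 1228 + 1) =
  4914. The dense regime uses B = sqrt d and K = 8 and needs only 17.\<close>

lemma N_hat_risk_upper_bound:
  assumes s: "1 \<le> s" "s \<le> d" and \<sigma>: "0 < \<sigma>" and \<theta>: "\<theta> \<in> B0 d s"
  shows "norm_risk d \<sigma> (N_hat \<sigma> s d) \<theta> \<le> ennreal (4914 * psi_sqrtQ \<sigma> s d)"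
proof -
  let ?a = "\<lambda>j. \<theta> j / \<sigma>"
  have sparse: "l0_norm d ?a \<le> s"
    using \<theta> \<sigma> by (simp add: B0_def l0_norm_def)
  have "(\<integral>\<^sup>+\<xi>. ennreal ((sqrt (max (Q_hat 1 s d (\<lambda>j. ?a j + \<xi> j)) 0) - l2_norm d ?a)\<^sup>2) \<partial>noise_law d)
      \<le> ennreal (4914 * (psi_sqrtQ \<sigma> s d / \<sigma>\<^sup>2))"
  proof (cases "real s < sqrt (real d)")
    case True
    define \<tau> where "\<tau> = sqrt (2 * ln (1 + real d / (real s)\<^sup>2))"
    note second = Q_hat_second_moment_sparse[OF s(1) True sparse, folded \<tau>_def]
    have "1 * 1 \<le> real s * \<tau>\<^sup>2"
      using s(1) second(1) by (intro mult_mono) (auto simp: one_le_power)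
    then have "(\<integral>\<^sup>+\<xi>. ennreal ((sqrt (max (Q_hat 1 s d (\<lambda>j. ?a j + \<xi> j)) 0) - l2_norm d ?a)\<^sup>2) \<partial>noise_law d)
      \<le> ennreal ((2 * 1228 + 1) * (real s * \<tau>\<^sup>2))"
      by (intro nn_integral_sqrt_estimator prob_space_noise_law second(2) l2_norm_nonneg) auto
    also have "(2 * 1228 + 1) * (real s * \<tau>\<^sup>2) = 4914 * (psi_sqrtQ \<sigma> s d / \<sigma>\<^sup>2)"
      using True \<sigma> by (simp add: psi_sqrtQ_def \<tau>_def)
    finally show ?thesis .
  next
    case False
    have "(\<integral>\<^sup>+\<xi>. ennreal ((sqrt (max (Q_hat 1 s d (\<lambda>j. ?a j + \<xi> j)) 0) - l2_norm d ?a)\<^sup>2) \<partial>noise_law d)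
      \<le> ennreal ((2 * 8 + 1) * sqrt (real d))"
      using False s
      by (intro nn_integral_sqrt_estimator prob_space_noise_law Q_hat_second_moment_dense l2_norm_nonneg) auto
    also have "\<dots> \<le> ennreal (4914 * (psi_sqrtQ \<sigma> s d / \<sigma>\<^sup>2))"
      using False \<sigma> by (intro ennreal_leI) (simp add: psi_sqrtQ_def)
    finally show ?thesis .
  qed
  then have "norm_risk d \<sigma> (N_hat \<sigma> s d) \<theta> \<le> ennreal (\<sigma>\<^sup>2) * ennreal (4914 * (psi_sqrtQ \<sigma> s d / \<sigma>\<^sup>2))"
    unfolding norm_risk_N_hat_scale[OF \<sigma>] by (rule mult_left_mono) simp
  also have "\<dots> = ennreal (4914 * psi_sqrtQ \<sigma> s d)"
    using \<sigma> by (subst ennreal_mult'[symmetric]) auto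
  finally show ?thesis .
qed

section \<open>Lower bound\<close>

text \<open>Completing the square in the exponent gives the likelihood ratio of N(a, 1) against N(0,
  1).\<close>

lemma distr_std_normal_shift:
  "distr std_normal borel (\<lambda>x. a + x) = density std_normal (\<lambda>x. ennreal (exp (a * x - a\<^sup>2 / 2)))"
proof (rule measure_eqI)
  fix A assume "A \<in> sets (distr std_normal borel (\<lambda>x. a + x))"
  then have [measurable]: "A \<in> sets borel"
    by simp
  have [measurable]: "(\<lambda>x. a + x) -` A \<in> sets borel"
    using measurable_sets_borel[of "\<lambda>x. a + x" borel A] by simp
  let ?f = "\<lambda>x. ennreal (std_normal_density (x - a)) * indicator A x"
  have "emeasure (distr std_normal borel (\<lambda>x. a + x)) A
      = (\<integral>\<^sup>+x. ennreal (std_normal_density x) * indicator ((\<lambda>x. a + x) -` A) x \<partial>lborel)"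
    by (simp add: emeasure_distr emeasure_density)
  also have "\<dots> = (\<integral>\<^sup>+x. ?f (a + 1 * x) \<partial>lborel)"
    by (intro nn_integral_cong) (auto split: split_indicator)
  also have "\<dots> = (\<integral>\<^sup>+x. ?f x \<partial>lborel)"
    using nn_integral_real_affine[of ?f 1 a] by simp
  also have "\<dots> = (\<integral>\<^sup>+x. ennreal (std_normal_density x) * (ennreal (exp (a * x - a\<^sup>2 / 2)) * indicator A x) \<partial>lborel)"
  proof (rule nn_integral_cong)
    fix x
    have "- (x - a)\<^sup>2 / 2 = - x\<^sup>2 / 2 + (a * x - a\<^sup>2 / 2)"
      by (simp add: power2_eq_square field_simps)
    then have "std_normal_density (x - a) = std_normal_density x * exp (a * x - a\<^sup>2 / 2)"
      by (simp only: std_normal_density_def exp_add mult.assoc)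
    then show "?f x = ennreal (std_normal_density x) * (ennreal (exp (a * x - a\<^sup>2 / 2)) * indicator A x)"
      by (simp add: ennreal_mult mult.assoc)
  qed
  also have "\<dots> = emeasure (density std_normal (\<lambda>x. ennreal (exp (a * x - a\<^sup>2 / 2)))) A"
    by (simp add: emeasure_density nn_integral_density)
  finally show "emeasure (distr std_normal borel (\<lambda>x. a + x)) A
      = emeasure (density std_normal (\<lambda>x. ennreal (exp (a * x - a\<^sup>2 / 2)))) A" .
qed simp

lemma nn_integral_std_normal_shift_density:
  "(\<integral>\<^sup>+x. ennreal (exp (a * x - a\<^sup>2 / 2)) \<partial>std_normal) = 1"
proof -
  interpret prob_space std_normal by (rule prob_space_std_normal)
  have "(\<integral>\<^sup>+x. ennreal (exp (a * x - a\<^sup>2 / 2)) \<partial>std_normal)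
      = emeasure (density std_normal (\<lambda>x. ennreal (exp (a * x - a\<^sup>2 / 2)))) UNIV"
    by (simp add: emeasure_density)
  also have "\<dots> = 1"
    unfolding distr_std_normal_shift[symmetric] using emeasure_space_1 by (simp add: emeasure_distr)
  finally show ?thesis .
qed

text \<open>The likelihood ratio of the unit-variance Gaussian shift by \<open>a\<close> against pure noise.\<close>

definition shift_density :: "nat \<Rightarrow> (nat \<Rightarrow> real) \<Rightarrow> (nat \<Rightarrow> real) \<Rightarrow> real" where
  "shift_density d a \<xi> = (\<Prod>j<d. exp (a j * \<xi> j - (a j)\<^sup>2 / 2))"

lemma shift_density_nonneg: "0 \<le> shift_density d a \<xi>"
  by (simp add: shift_density_def prod_nonneg)

lemma shift_density_measurable [measurable]: "shift_density d a \<in> borel_measurable (noise_law d)"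
  unfolding shift_density_def[abs_def] noise_law_def by measurable

text \<open>Both sides equal the product of the one-dimensional shifted laws \<open>\<nu> j\<close>.
  By \<open>PiM_eqI\<close> it suffices to compare boxes, where preimages, the density and the
  indicator all factorise.\<close>

lemma distr_noise_law_shift:
  "distr (noise_law d) (obs_space d) (\<lambda>\<xi>. \<lambda>j\<in>{..<d}. a j + \<xi> j)
    = density (noise_law d) (\<lambda>\<xi>. ennreal (shift_density d a \<xi>))"
proof -
  interpret prob_space std_normal by (rule prob_space_std_normal)
  interpret N: product_sigma_finite "\<lambda>_::nat. std_normal" ..
  define \<nu> where "\<nu> j = distr std_normal borel (\<lambda>x. a j + x)" for j
  have prob_\<nu>: "prob_space (\<nu> j)" for j
    unfolding \<nu>_def by (rule prob_space_distr) simp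
  interpret product_sigma_finite \<nu>
    by (simp add: product_sigma_finite_def prob_\<nu> prob_space_imp_sigma_finite)
  have sets_\<nu>: "sets (\<nu> j) = sets borel" for j
    by (simp add: \<nu>_def)
  have "distr (noise_law d) (obs_space d) (\<lambda>\<xi>. \<lambda>j\<in>{..<d}. a j + \<xi> j) = PiM {..<d} \<nu>"
  proof (rule PiM_eqI)
    show "sets (distr (noise_law d) (obs_space d) (\<lambda>\<xi>. \<lambda>j\<in>{..<d}. a j + \<xi> j)) = sets (PiM {..<d} \<nu>)"
      unfolding obs_space_def by (simp add: sets_\<nu> cong: sets_PiM_cong)
    fix A assume "\<And>i. i \<in> {..<d} \<Longrightarrow> A i \<in> sets (\<nu> i)"
    then have A: "A i \<in> sets borel" if "i < d" for i
      using that by (simp add: sets_\<nu>)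
    have vimage: "(\<lambda>x. a j + x) -` A j \<in> sets borel" if "j < d" for j
      using measurable_sets_borel[of "\<lambda>x. a j + x" borel "A j"] A[OF that] by simp
    have meas: "(\<lambda>\<xi>. \<lambda>j\<in>{..<d}. a j + \<xi> j) \<in> measurable (noise_law d) (obs_space d)"
      unfolding noise_law_def obs_space_def by measurable
    have box: "Pi\<^sub>E {..<d} A \<in> sets (obs_space d)"
      unfolding obs_space_def using A by (intro sets_PiM_I_finite) auto
    have "(\<lambda>\<xi>. \<lambda>j\<in>{..<d}. a j + \<xi> j) -` Pi\<^sub>E {..<d} A \<inter> space (noise_law d)
        = (\<Pi>\<^sub>E j\<in>{..<d}. (\<lambda>x. a j + x) -` A j)"
      by (auto simp: noise_law_def space_PiM PiE_iff extensional_def)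
    then have "emeasure (distr (noise_law d) (obs_space d) (\<lambda>\<xi>. \<lambda>j\<in>{..<d}. a j + \<xi> j)) (Pi\<^sub>E {..<d} A)
        = emeasure (noise_law d) (\<Pi>\<^sub>E j\<in>{..<d}. (\<lambda>x. a j + x) -` A j)"
      using emeasure_distr[OF meas box] by simp
    also have "\<dots> = (\<Prod>j<d. emeasure std_normal ((\<lambda>x. a j + x) -` A j))"
      unfolding noise_law_def using vimage by (intro N.emeasure_PiM) auto
    also have "\<dots> = (\<Prod>j<d. emeasure (\<nu> j) (A j))"
      using A by (intro prod.cong) (auto simp: \<nu>_def emeasure_distr)
    finally show "emeasure (distr (noise_law d) (obs_space d) (\<lambda>\<xi>. \<lambda>j\<in>{..<d}. a j + \<xi> j)) (Pi\<^sub>E {..<d} A)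
        = (\<Prod>j<d. emeasure (\<nu> j) (A j))" .
  qed simp
  moreover have "density (noise_law d) (\<lambda>\<xi>. ennreal (shift_density d a \<xi>)) = PiM {..<d} \<nu>"
  proof (rule PiM_eqI)
    show "sets (density (noise_law d) (\<lambda>\<xi>. ennreal (shift_density d a \<xi>))) = sets (PiM {..<d} \<nu>)"
      unfolding noise_law_def by (simp add: sets_\<nu> cong: sets_PiM_cong)
    fix A assume "\<And>i. i \<in> {..<d} \<Longrightarrow> A i \<in> sets (\<nu> i)"
    then have A: "A i \<in> sets borel" if "i < d" for i
      using that by (simp add: sets_\<nu>)
    let ?g = "\<lambda>j x. ennreal (exp (a j * x - (a j)\<^sup>2 / 2)) * indicator (A j) x"
    have box: "Pi\<^sub>E {..<d} A \<in> sets (noise_law d)"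
      unfolding noise_law_def using A by (intro sets_PiM_I_finite) auto
    have "emeasure (density (noise_law d) (\<lambda>\<xi>. ennreal (shift_density d a \<xi>))) (Pi\<^sub>E {..<d} A)
        = (\<integral>\<^sup>+\<xi>. ennreal (shift_density d a \<xi>) * indicator (Pi\<^sub>E {..<d} A) \<xi> \<partial>noise_law d)"
      using box by (intro emeasure_density) auto
    also have "\<dots> = (\<integral>\<^sup>+\<xi>. (\<Prod>j<d. ?g j (\<xi> j)) \<partial>noise_law d)"
    proof (rule nn_integral_cong)
      fix \<xi> assume "\<xi> \<in> space (noise_law d)"
      then have "\<xi> \<in> extensional {..<d}"
        by (simp add: noise_law_def space_PiM PiE_def)
      then have "(indicator (Pi\<^sub>E {..<d} A) \<xi> :: ennreal) = (\<Prod>j<d. indicator (A j) (\<xi> j))"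
      proof (cases "\<forall>j<d. \<xi> j \<in> A j")
        case True
        then show ?thesis
          using \<open>\<xi> \<in> extensional {..<d}\<close> by (simp add: PiE_def Pi_iff)
      next
        case False
        then obtain k where "k < d" "\<xi> k \<notin> A k"
          by blast
        then have "\<xi> \<notin> Pi\<^sub>E {..<d} A" "(\<Prod>j<d. indicator (A j) (\<xi> j)) = (0 :: ennreal)"
          by (auto intro!: prod_zero bexI[of _ k])
        then show ?thesis
          by simp
      qed
      then show "ennreal (shift_density d a \<xi>) * indicator (Pi\<^sub>E {..<d} A) \<xi> = (\<Prod>j<d. ?g j (\<xi> j))"
        by (simp add: prod.distrib shift_density_def prod_ennreal)
    qed
    also have "\<dots> = (\<Prod>j<d. \<integral>\<^sup>+x. ?g j x \<partial>std_normal)"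
      unfolding noise_law_def using A by (intro N.product_nn_integral_prod) auto
    also have "\<dots> = (\<Prod>j<d. emeasure (\<nu> j) (A j))"
      unfolding \<nu>_def distr_std_normal_shift using A by (intro prod.cong) (auto simp: emeasure_density)
    finally show "emeasure (density (noise_law d) (\<lambda>\<xi>. ennreal (shift_density d a \<xi>))) (Pi\<^sub>E {..<d} A)
        = (\<Prod>j<d. emeasure (\<nu> j) (A j))" .
  qed simp
  ultimately show ?thesis
    by simp
qed

text \<open>In each coordinate the product of two ratios is exp (a b) times the ratio for the shift
  a + b, which has mean one. Taking \<open>b\<close> to be zero shows that
  \<open>shift_density\<close> itself has total mass one.\<close>

lemma nn_integral_shift_density_mult:
  "(\<integral>\<^sup>+\<xi>. ennreal (shift_density d a \<xi> * shift_density d b \<xi>) \<partial>noise_law d) = ennreal (exp (\<Sum>j<d. a j * b j))"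
proof -
  interpret prob_space std_normal by (rule prob_space_std_normal)
  interpret product_sigma_finite "\<lambda>_::nat. std_normal" ..
  let ?h = "\<lambda>j x. ennreal (exp (a j * b j)) * ennreal (exp ((a j + b j) * x - (a j + b j)\<^sup>2 / 2))"
  have "(\<integral>\<^sup>+\<xi>. ennreal (shift_density d a \<xi> * shift_density d b \<xi>) \<partial>noise_law d)
      = (\<integral>\<^sup>+\<xi>. (\<Prod>j<d. ?h j (\<xi> j)) \<partial>noise_law d)"
  proof (rule nn_integral_cong)
    fix \<xi> :: "nat \<Rightarrow> real"
    have "exp (a j * x - (a j)\<^sup>2 / 2) * exp (b j * x - (b j)\<^sup>2 / 2)
        = exp (a j * b j) * exp ((a j + b j) * x - (a j + b j)\<^sup>2 / 2)" for j x
      by (simp add: exp_add[symmetric] power2_eq_square field_simps)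
    then show "ennreal (shift_density d a \<xi> * shift_density d b \<xi>) = (\<Prod>j<d. ?h j (\<xi> j))"
      by (simp add: shift_density_def prod.distrib[symmetric] prod_ennreal ennreal_mult[symmetric])
  qed
  also have "\<dots> = (\<Prod>j<d. \<integral>\<^sup>+x. ?h j x \<partial>std_normal)"
    unfolding noise_law_def by (intro product_nn_integral_prod) auto
  also have "\<dots> = (\<Prod>j<d. ennreal (exp (a j * b j)))"
    by (simp add: nn_integral_cmult nn_integral_std_normal_shift_density)
  also have "\<dots> = ennreal (exp (\<Sum>j<d. a j * b j))"
    by (simp add: prod_ennreal exp_sum)
  finally show ?thesis .
qed

text \<open>All risks become integrals over the same noise law of the same statistic, the estimator
  evaluated at \<sigma> \<xi>; the parameter survives only in the weight and in the target. Risks at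
  different parameters can then be averaged.\<close>

lemma norm_risk_shift_density:
  assumes [measurable]: "T \<in> estimators d" and \<sigma>: "0 < \<sigma>"
  shows "norm_risk d \<sigma> T (\<lambda>j\<in>{..<d}. \<sigma> * a j)
    = (\<integral>\<^sup>+\<xi>. ennreal (shift_density d a \<xi>) * ennreal ((T (\<lambda>j\<in>{..<d}. \<sigma> * \<xi> j) - \<sigma> * l2_norm d a)\<^sup>2) \<partial>noise_law d)"
proof -
  have T[measurable]: "T \<in> borel_measurable (obs_space d)"
    using assms by (simp add: estimators_def)
  have maps[measurable]: "(\<lambda>\<xi>. \<lambda>j\<in>{..<d}. \<sigma> * \<xi> j) \<in> measurable (obs_space d) (obs_space d)"
    "(\<lambda>\<xi>. \<lambda>j\<in>{..<d}. \<sigma> * \<xi> j) \<in> measurable (noise_law d) (obs_space d)"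
    "(\<lambda>\<xi>. \<lambda>j\<in>{..<d}. a j + \<xi> j) \<in> measurable (noise_law d) (obs_space d)"
    "(\<lambda>\<xi>. \<lambda>j\<in>{..<d}. (\<lambda>j\<in>{..<d}. \<sigma> * a j) j + \<sigma> * \<xi> j) \<in> measurable (noise_law d) (obs_space d)"
    unfolding noise_law_def obs_space_def by measurable
  have norm: "l2_norm d (\<lambda>j\<in>{..<d}. \<sigma> * a j) = \<sigma> * l2_norm d a"
  proof -
    have "L2_set (\<lambda>j\<in>{..<d}. \<sigma> * a j) {..<d} = L2_set (\<lambda>j. \<sigma> * a j) {..<d}"
      by (rule L2_set_cong) auto
    then show ?thesis
      using L2_set_right_distrib[of \<sigma> a "{..<d}"] \<sigma> by (simp add: l2_norm_def)
  qed
  have "norm_risk d \<sigma> T (\<lambda>j\<in>{..<d}. \<sigma> * a j)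
      = (\<integral>\<^sup>+\<xi>. ennreal ((T (\<lambda>j\<in>{..<d}. (\<lambda>j\<in>{..<d}. \<sigma> * a j) j + \<sigma> * \<xi> j) - \<sigma> * l2_norm d a)\<^sup>2) \<partial>noise_law d)"
    unfolding norm_risk_def obs_law_def norm by (rule nn_integral_distr[OF maps(4)]) measurable
  also have "\<dots> = (\<integral>\<^sup>+\<xi>. ennreal ((T (\<lambda>j\<in>{..<d}. \<sigma> * (\<lambda>j\<in>{..<d}. a j + \<xi> j) j) - \<sigma> * l2_norm d a)\<^sup>2) \<partial>noise_law d)"
    by (intro nn_integral_cong) (simp add: distrib_left cong: restrict_cong)
  also have "\<dots> = (\<integral>\<^sup>+\<xi>. ennreal ((T (\<lambda>j\<in>{..<d}. \<sigma> * \<xi> j) - \<sigma> * l2_norm d a)\<^sup>2)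
      \<partial>distr (noise_law d) (obs_space d) (\<lambda>\<xi>. \<lambda>j\<in>{..<d}. a j + \<xi> j))"
    by (rule nn_integral_distr[OF maps(3), symmetric]) measurable
  also have "\<dots> = (\<integral>\<^sup>+\<xi>. ennreal (shift_density d a \<xi>) * ennreal ((T (\<lambda>j\<in>{..<d}. \<sigma> * \<xi> j) - \<sigma> * l2_norm d a)\<^sup>2) \<partial>noise_law d)"
    unfolding distr_noise_law_shift by (rule nn_integral_density) auto
  finally show ?thesis .
qed

section \<open>Comparison of pure noise with a mixture\<close>

text \<open>If \<open>g\<close> has bounded second moment, one statistic cannot be close to 0 under
  \<open>M\<close> and close to N under the reweighted law. Integrating N g \<le> g |U - N| + g |U|
  quantifies this.\<close>

lemma second_moment_method_bound:
  fixes U g :: "'a \<Rightarrow> real" and N K R :: real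
  assumes "prob_space M" and [measurable]: "U \<in> borel_measurable M" "g \<in> borel_measurable M"
    and g: "\<And>x. 0 \<le> g x" "(\<integral>\<^sup>+x. ennreal (g x) \<partial>M) = 1" "(\<integral>\<^sup>+x. ennreal ((g x)\<^sup>2) \<partial>M) \<le> ennreal K"
    and K: "0 < K" and N: "0 < N" and R: "0 \<le> R"
    and null: "(\<integral>\<^sup>+x. ennreal ((U x)\<^sup>2) \<partial>M) \<le> ennreal R"
    and alt: "(\<integral>\<^sup>+x. ennreal (g x) * ennreal ((U x - N)\<^sup>2) \<partial>M) \<le> ennreal R"
  shows "N\<^sup>2 \<le> 2 * (1 + K) * R"
proof -
  \<comment> \<open>Weighted arithmetic-geometric means stand in for Cauchy-Schwarz. The weights are
    chosen so that the two terms free of \<open>U\<close> integrate to at most N/4 each and can be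
    absorbed into the left-hand side.\<close>
  have pointwise: "N * g x \<le> 1 / N * (g x * (U x - N)\<^sup>2) + N / 4 * g x + K / N * (U x)\<^sup>2 + N / (4 * K) * (g x)\<^sup>2" for x
  proof -
    have "N * w \<le> w\<^sup>2 + N\<^sup>2 / 4" for w
      using zero_le_power2[of "w - N / 2"] by (simp add: power2_diff power_divide mult.commute)
    from this[of "\<bar>U x - N\<bar>"] have "\<bar>U x - N\<bar> \<le> 1 / N * (U x - N)\<^sup>2 + N / 4"
      using N by (simp add: field_simps power2_eq_square)
    then have "g x * \<bar>U x - N\<bar> \<le> g x * (1 / N * (U x - N)\<^sup>2 + N / 4)"
      using g(1) by (intro mult_left_mono)
    moreover have "g x * \<bar>U x\<bar> \<le> K / N * (U x)\<^sup>2 + N / (4 * K) * (g x)\<^sup>2"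
    proof -
      have "0 \<le> N / K * (K / N * \<bar>U x\<bar> - g x / 2)\<^sup>2"
        using N K by simp
      also have "\<dots> = K / N * (U x)\<^sup>2 + N / (4 * K) * (g x)\<^sup>2 - g x * \<bar>U x\<bar>"
        using N K by (simp add: power2_diff power_mult_distrib power_divide field_simps power2_eq_square)
      finally show ?thesis
        by simp
    qed
    moreover have "g x * N \<le> g x * (\<bar>U x - N\<bar> + \<bar>U x\<bar>)"
      using g(1)[of x] by (intro mult_left_mono) auto
    ultimately show ?thesis
      by (simp add: algebra_simps)
  qed
  have "ennreal N = (\<integral>\<^sup>+x. ennreal N * ennreal (g x) \<partial>M)"
    by (subst nn_integral_cmult) (auto simp: g)
  also have "\<dots> \<le> (\<integral>\<^sup>+x. ennreal (1 / N) * (ennreal (g x) * ennreal ((U x - N)\<^sup>2)) + ennreal (N / 4) * ennreal (g x)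
      + ennreal (K / N) * ennreal ((U x)\<^sup>2) + ennreal (N / (4 * K)) * ennreal ((g x)\<^sup>2) \<partial>M)"
  proof (rule nn_integral_mono)
    fix x
    have "ennreal N * ennreal (g x) = ennreal (N * g x)"
      using N g by (simp add: ennreal_mult)
    also have "\<dots> \<le> ennreal (1 / N * (g x * (U x - N)\<^sup>2) + N / 4 * g x + K / N * (U x)\<^sup>2 + N / (4 * K) * (g x)\<^sup>2)"
      by (intro ennreal_leI pointwise)
    also have "\<dots> = ennreal (1 / N) * (ennreal (g x) * ennreal ((U x - N)\<^sup>2)) + ennreal (N / 4) * ennreal (g x)
      + ennreal (K / N) * ennreal ((U x)\<^sup>2) + ennreal (N / (4 * K)) * ennreal ((g x)\<^sup>2)"
    proof -
      have "0 \<le> 1 / N" "0 \<le> N / 4" "0 \<le> K / N" "0 \<le> N / (4 * K)"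
        using N K by auto
      then show ?thesis
        by (simp only: ennreal_mult ennreal_plus zero_le_power2 add_nonneg_nonneg mult_nonneg_nonneg g(1))
    qed
    finally show "ennreal N * ennreal (g x) \<le> \<dots>" .
  qed
  also have "\<dots> = ennreal (1 / N) * (\<integral>\<^sup>+x. ennreal (g x) * ennreal ((U x - N)\<^sup>2) \<partial>M) + ennreal (N / 4) * (\<integral>\<^sup>+x. ennreal (g x) \<partial>M)
      + ennreal (K / N) * (\<integral>\<^sup>+x. ennreal ((U x)\<^sup>2) \<partial>M) + ennreal (N / (4 * K)) * (\<integral>\<^sup>+x. ennreal ((g x)\<^sup>2) \<partial>M)"
    by (simp add: nn_integral_add nn_integral_cmult)
  also have "\<dots> \<le> ennreal (1 / N) * ennreal R + ennreal (N / 4) * ennreal 1 + ennreal (K / N) * ennreal R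
      + ennreal (N / (4 * K)) * ennreal K"
    by (intro add_mono mult_left_mono null alt g(3)) (auto simp: g(2))
  also have "\<dots> = ennreal (1 / N * R + N / 4 * 1 + K / N * R + N / (4 * K) * K)"
  proof -
    have "0 \<le> 1 / N" "0 \<le> N / 4" "0 \<le> K / N" "0 \<le> N / (4 * K)"
      using N K by auto
    then show ?thesis
      using R K by (simp only: ennreal_mult ennreal_plus add_nonneg_nonneg mult_nonneg_nonneg zero_le_one less_imp_le)
  qed
  finally have "N \<le> 1 / N * R + N / 4 * 1 + K / N * R + N / (4 * K) * K"
    using N K R by (subst (asm) ennreal_le_iff) auto
  moreover have "N / (4 * K) * K = N / 4"
    using K by simp
  ultimately have "N / 2 \<le> 1 / N * R + K / N * R"
    by linarith
  then have "N * (N / 2) \<le> N * (1 / N * R + K / N * R)"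
    using N by (intro mult_left_mono) auto
  also have "\<dots> = R + K * R"
    using N by (simp add: distrib_left)
  finally show ?thesis
    by (simp add: power2_eq_square algebra_simps)
qed

section \<open>Combinatorics of block supports\<close>

text \<open>\<open>\<omega> i\<close> is the position of the spike inside the \<open>i\<close>-th block of length \<open>m\<close>.\<close>

definition block_spikes :: "nat \<Rightarrow> nat \<Rightarrow> (nat \<Rightarrow> nat) \<Rightarrow> nat set" where
  "block_spikes s m \<omega> = (\<lambda>i. i * m + \<omega> i) ` {..<s}"

text \<open>Quotient and remainder modulo \<open>m\<close> recover the block and the position inside
  it.\<close>

lemma block_spikes_index_inj:
  fixes i i' k k' m :: nat
  assumes "i * m + k = i' * m + k'" "k < m" "k' < m"
  shows "i = i'" "k = k'"
proof -
  have "(q * m + r) div m = q" if "r < m" for q r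
    using that by simp
  from this[of k i] this[of k' i'] show "i = i'"
    using assms by simp
  then show "k = k'"
    using assms(1) by simp
qed

text \<open>Different blocks are disjoint, so a common spike must come from the same block with the
  same position.\<close>

lemma card_block_spikes_Int:
  assumes \<omega>: "\<omega> \<in> {..<s} \<rightarrow> {..<m}" and \<omega>': "\<omega>' \<in> {..<s} \<rightarrow> {..<m}"
  shows "card (block_spikes s m \<omega> \<inter> block_spikes s m \<omega>') = card {i \<in> {..<s}. \<omega> i = \<omega>' i}"
proof -
  have lt: "\<omega> i < m" "\<omega>' i < m" if "i < s" for i
    using that \<omega> \<omega>' by auto
  have "block_spikes s m \<omega> \<inter> block_spikes s m \<omega>' = (\<lambda>i. i * m + \<omega> i) ` {i \<in> {..<s}. \<omega> i = \<omega>' i}"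
  proof (intro set_eqI iffI)
    fix j assume "j \<in> block_spikes s m \<omega> \<inter> block_spikes s m \<omega>'"
    then obtain i i' where i: "i < s" "i' < s" "j = i * m + \<omega> i" "j = i' * m + \<omega>' i'"
      by (auto simp: block_spikes_def)
    then have "i = i'" "\<omega> i = \<omega>' i'"
      using block_spikes_index_inj[of i m "\<omega> i" i' "\<omega>' i'"] lt by auto
    then show "j \<in> (\<lambda>i. i * m + \<omega> i) ` {i \<in> {..<s}. \<omega> i = \<omega>' i}"
      using i by auto
  qed (force simp: block_spikes_def)
  moreover have "inj_on (\<lambda>i. i * m + \<omega> i) {i \<in> {..<s}. \<omega> i = \<omega>' i}"
    using lt block_spikes_index_inj(1) by (auto simp: inj_on_def)
  ultimately show ?thesis
    by (simp only: card_image)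
qed

lemma block_spikes_subset:
  assumes "\<omega> \<in> {..<s} \<rightarrow> {..<m}" "s * m \<le> d"
  shows "block_spikes s m \<omega> \<subseteq> {..<d}"
proof
  fix j assume "j \<in> block_spikes s m \<omega>"
  then obtain i where i: "i < s" "j = i * m + \<omega> i"
    by (auto simp: block_spikes_def)
  then have "j < i * m + m"
    using assms(1) by auto
  also have "\<dots> \<le> s * m"
    using mult_le_mono1[of "Suc i" s m] i by simp
  finally show "j \<in> {..<d}"
    using assms(2) by simp
qed

text \<open>The sum factorises over blocks: in each block one position agrees and contributes
  \<open>x\<close>, the other m - 1 contribute 1. Divided by m^s this is the generating function of
  a Binomial(s, 1/m) number of agreements.\<close>

lemma sum_PiE_agreements:
  fixes x :: real
  assumes "\<omega> \<in> {..<s} \<rightarrow> {..<m}"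
  shows "(\<Sum>\<omega>'\<in>{..<s} \<rightarrow>\<^sub>E {..<m}. x ^ card {i \<in> {..<s}. \<omega> i = \<omega>' i}) = (real m - 1 + x) ^ s"
proof -
  have "(\<Sum>\<omega>'\<in>{..<s} \<rightarrow>\<^sub>E {..<m}. x ^ card {i \<in> {..<s}. \<omega> i = \<omega>' i})
      = (\<Sum>\<omega>'\<in>{..<s} \<rightarrow>\<^sub>E {..<m}. \<Prod>i<s. if \<omega> i = \<omega>' i then x else 1)"
    by (simp add: prod.If_cases Int_def)
  also have "\<dots> = (\<Prod>i<s. \<Sum>k<m. if \<omega> i = k then x else 1)"
    by (rule prod_sum_PiE[symmetric]) auto
  also have "\<dots> = (\<Prod>i<s. real m - 1 + x)"
  proof (rule prod.cong)
    fix i assume i: "i \<in> {..<s}"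
    then have "\<omega> i < m"
      using assms by auto
    have "(\<Sum>k<m. if \<omega> i = k then x else 1) = (\<Sum>k<m. 1 + (if \<omega> i = k then x - 1 else 0))"
      by (intro sum.cong) auto
    also have "\<dots> = real m - 1 + x"
      using \<open>\<omega> i < m\<close> by (simp add: sum.distrib)
    finally show "(\<Sum>k<m. if \<omega> i = k then x else 1) = real m - 1 + x" .
  qed simp
  finally show ?thesis
    by simp
qed

section \<open>The minimax lower bound\<close>

text \<open>The logarithmic bound holds for every \<open>s \<le> d\<close>, so it can also be
  applied at the boundary sparsity. For a finite supremum R, the risks at zero and at all spiked
  vectors are at most R, and \<open>second_moment_method_bound\<close> applies with K = exp
  2.\<close>

lemma minimax_risk_lower_bound:
  assumes s: "1 \<le> s" "s \<le> d" and \<sigma>: "0 < \<sigma>" and T: "T \<in> estimators d"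
  shows "ennreal (\<sigma>\<^sup>2 * (real s * ln (1 + real d / (real s)\<^sup>2)) / (2 * (1 + exp 2)))
    \<le> (SUP \<theta>\<in>B0 d s. norm_risk d \<sigma> T \<theta>)"
proof (cases "SUP \<theta>\<in>B0 d s. norm_risk d \<sigma> T \<theta>" rule: ennreal_cases)
  case top
  show ?thesis
    unfolding top by (rule top_greatest)
next
  case (real R)
  define L where "L = ln (1 + real d / (real s)\<^sup>2)"
  \<comment> \<open>This height gives exp (\<rho>^2) - 1 = d/s^2, the largest order for which the
    mixture density keeps a bounded second moment.\<close>
  define \<rho> where "\<rho> = sqrt L"
  define m where "m = d div s"
  define \<Omega> where "\<Omega> = {..<s} \<rightarrow>\<^sub>E {..<m}"
  \<comment> \<open>Signals on the unit-noise scale; the actual parameters are \<sigma> times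
    \<open>a \<omega>\<close>.\<close>
  define a where "a \<omega> j = (if j \<in> block_spikes s m \<omega> then \<rho> else 0)" for \<omega> j
  have ratio: "0 < real d / (real s)\<^sup>2"
    using s by simp
  then have L: "0 < L" "exp L = 1 + real d / (real s)\<^sup>2"
    by (simp_all add: L_def)
  have \<rho>: "0 < \<rho>" "\<rho>\<^sup>2 = L"
    using L by (simp_all add: \<rho>_def)
  \<comment> \<open>The coordinates left over number \<open>d mod s\<close> < s \<le> s m, so
    discarding them costs at most a factor of two.\<close>
  have m: "1 \<le> m" "s * m \<le> d" "real d \<le> 2 * real s * real m"
  proof -
    show m1: "1 \<le> m"
      using s by (simp add: m_def Suc_le_eq div_greater_zero_iff)
    show "s * m \<le> d"
      by (simp add: m_def)
    have "s * m + d mod s = d"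
      by (simp add: m_def)
    moreover have "d mod s < s"
      using s by simp
    ultimately have "d < s * m + s"
      by linarith
    also have "s * m + s \<le> 2 * s * m"
      using m1 mult_le_mono2[of 1 m s] by simp
    finally have "real d \<le> real (2 * s * m)"
      by (simp only: of_nat_le_iff less_imp_le)
    then show "real d \<le> 2 * real s * real m"
      by simp
  qed
  have fin: "finite \<Omega>" and card_\<Omega>: "real (card \<Omega>) = real m ^ s"
    by (simp_all add: \<Omega>_def finite_PiE card_PiE)
  have card_pos: "0 < real (card \<Omega>)"
    using m(1) by (simp add: card_\<Omega>)
  have \<Omega>: "\<omega> \<in> {..<s} \<rightarrow> {..<m}" if "\<omega> \<in> \<Omega>" for \<omega>
    using that by (auto simp: \<Omega>_def)
  have inner: "(\<Sum>j<d. a \<omega> j * a \<omega>' j) = L * real (card {i \<in> {..<s}. \<omega> i = \<omega>' i})"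
    if "\<omega> \<in> \<Omega>" "\<omega>' \<in> \<Omega>" for \<omega> \<omega>'
  proof -
    have "(\<Sum>j<d. a \<omega> j * a \<omega>' j) = (\<Sum>j<d. if j \<in> block_spikes s m \<omega> \<inter> block_spikes s m \<omega>' then L else 0)"
      using \<rho> by (intro sum.cong) (auto simp: a_def power2_eq_square)
    also have "\<dots> = L * real (card (block_spikes s m \<omega> \<inter> block_spikes s m \<omega>'))"
      using block_spikes_subset[OF \<Omega>[OF that(1)] m(2)]
      by (simp add: sum.If_cases Int_absorb1 le_infI1 mult.commute del: Int_iff)
    also have "\<dots> = L * real (card {i \<in> {..<s}. \<omega> i = \<omega>' i})"
      using card_block_spikes_Int[OF \<Omega>[OF that(1)] \<Omega>[OF that(2)]] by simp
    finally show ?thesis .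
  qed
  have norm: "l2_norm d (a \<omega>) = sqrt (real s * L)" if "\<omega> \<in> \<Omega>" for \<omega>
    using inner[OF that that] by (simp add: l2_norm_def L2_set_def power2_eq_square mult.commute)
  have in_B0: "(\<lambda>j\<in>{..<d}. \<sigma> * a \<omega> j) \<in> B0 d s" if "\<omega> \<in> \<Omega>" for \<omega>
  proof -
    have "{j \<in> {..<d}. (\<lambda>j\<in>{..<d}. \<sigma> * a \<omega> j) j \<noteq> 0} \<subseteq> block_spikes s m \<omega>"
      by (auto simp: a_def)
    then have "card {j \<in> {..<d}. (\<lambda>j\<in>{..<d}. \<sigma> * a \<omega> j) j \<noteq> 0} \<le> card (block_spikes s m \<omega>)"
      by (intro card_mono) (simp_all add: block_spikes_def)
    also have "\<dots> \<le> s"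
      unfolding block_spikes_def using card_image_le[of "{..<s}"] by simp
    finally show ?thesis
      by (simp add: B0_def l0_norm_def obs_space_def space_PiM)
  qed
  \<comment> \<open>The zero vector is written as a multiple of \<sigma> to match
    \<open>norm_risk_shift_density\<close> with \<open>a\<close> zero.\<close>
  have zero_in_B0: "(\<lambda>j\<in>{..<d}. \<sigma> * 0) \<in> B0 d s"
    by (simp add: B0_def l0_norm_def obs_space_def space_PiM)
  have risk: "norm_risk d \<sigma> T \<theta> \<le> ennreal R" if "\<theta> \<in> B0 d s" for \<theta>
    using SUP_upper[OF that, of "norm_risk d \<sigma> T"] real by simp
  define U where "U \<xi> = T (\<lambda>j\<in>{..<d}. \<sigma> * \<xi> j)" for \<xi>
  define N where "N = \<sigma> * sqrt (real s * L)"
  \<comment> \<open>The density of the uniform mixture over \<open>\<Omega>\<close> with respect to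
    the noise law.\<close>
  define g where "g \<xi> = (\<Sum>\<omega>\<in>\<Omega>. 1 / real (card \<Omega>) * shift_density d (a \<omega>) \<xi>)" for \<xi>
  let ?w = "1 / real (card \<Omega>)"
  have w_nonneg: "0 \<le> ?w"
    by simp
  have [measurable]: "T \<in> borel_measurable (obs_space d)"
    using T by (simp add: estimators_def)
  have [measurable]: "(\<lambda>\<xi>. \<lambda>j\<in>{..<d}. \<sigma> * \<xi> j) \<in> measurable (noise_law d) (obs_space d)"
    unfolding noise_law_def obs_space_def by measurable
  have U[measurable]: "U \<in> borel_measurable (noise_law d)"
    unfolding U_def[abs_def] by measurable
  have g_meas[measurable]: "g \<in> borel_measurable (noise_law d)"
    unfolding g_def[abs_def] by measurable
  have g_ennreal: "ennreal (g \<xi>) = (\<Sum>\<omega>\<in>\<Omega>. ennreal ?w * ennreal (shift_density d (a \<omega>) \<xi>))" for \<xi>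
    unfolding g_def by (simp only: sum_ennreal[symmetric] ennreal_mult mult_nonneg_nonneg w_nonneg shift_density_nonneg)
  have average: "(\<Sum>\<omega>\<in>\<Omega>. ennreal ?w * c) = c" for c
  proof -
    have "(\<Sum>\<omega>\<in>\<Omega>. ennreal ?w * c) = ennreal (real (card \<Omega>)) * ennreal ?w * c"
      by (simp add: ennreal_of_nat_eq_real_of_nat mult.assoc)
    also have "ennreal (real (card \<Omega>)) * ennreal ?w = 1"
      using card_pos by (subst ennreal_mult[symmetric]) auto
    finally show ?thesis
      by simp
  qed
  have null: "(\<integral>\<^sup>+\<xi>. ennreal ((U \<xi>)\<^sup>2) \<partial>noise_law d) \<le> ennreal R"
    using norm_risk_shift_density[OF T \<sigma>, of "\<lambda>_. 0"] risk[OF zero_in_B0]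
    by (simp add: shift_density_def U_def l2_norm_def L2_set_def)
  have alt: "(\<integral>\<^sup>+\<xi>. ennreal (g \<xi>) * ennreal ((U \<xi> - N)\<^sup>2) \<partial>noise_law d) \<le> ennreal R"
  proof -
    have "(\<integral>\<^sup>+\<xi>. ennreal (g \<xi>) * ennreal ((U \<xi> - N)\<^sup>2) \<partial>noise_law d)
        = (\<integral>\<^sup>+\<xi>. (\<Sum>\<omega>\<in>\<Omega>. ennreal ?w * (ennreal (shift_density d (a \<omega>) \<xi>) * ennreal ((U \<xi> - N)\<^sup>2))) \<partial>noise_law d)"
      unfolding g_ennreal sum_distrib_right by (simp only: mult.assoc)
    also have "\<dots> = (\<Sum>\<omega>\<in>\<Omega>. ennreal ?w * (\<integral>\<^sup>+\<xi>. ennreal (shift_density d (a \<omega>) \<xi>) * ennreal ((U \<xi> - N)\<^sup>2) \<partial>noise_law d))"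
      by (subst nn_integral_sum) (auto intro!: sum.cong nn_integral_cmult)
    also have "\<dots> \<le> (\<Sum>\<omega>\<in>\<Omega>. ennreal ?w * ennreal R)"
    proof (intro sum_mono mult_left_mono)
      fix \<omega> assume \<omega>: "\<omega> \<in> \<Omega>"
      show "(\<integral>\<^sup>+\<xi>. ennreal (shift_density d (a \<omega>) \<xi>) * ennreal ((U \<xi> - N)\<^sup>2) \<partial>noise_law d) \<le> ennreal R"
        using norm_risk_shift_density[OF T \<sigma>, of "a \<omega>"] risk[OF in_B0[OF \<omega>]]
        by (simp add: U_def N_def norm[OF \<omega>])
    qed simp
    also have "\<dots> = ennreal R"
      by (rule average)
    finally show ?thesis .
  qed
  have mass: "(\<integral>\<^sup>+\<xi>. ennreal (g \<xi>) \<partial>noise_law d) = 1"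
  proof -
    have one: "(\<integral>\<^sup>+\<xi>. ennreal (shift_density d (a \<omega>) \<xi>) \<partial>noise_law d) = 1" for \<omega>
      using nn_integral_shift_density_mult[of d "a \<omega>" "\<lambda>_. 0"] by (simp add: shift_density_def)
    have "(\<integral>\<^sup>+\<xi>. ennreal (g \<xi>) \<partial>noise_law d)
        = (\<Sum>\<omega>\<in>\<Omega>. ennreal ?w * (\<integral>\<^sup>+\<xi>. ennreal (shift_density d (a \<omega>) \<xi>) \<partial>noise_law d))"
      unfolding g_ennreal by (subst nn_integral_sum) (auto intro!: sum.cong nn_integral_cmult)
    then show ?thesis
      unfolding one average .
  qed
  have second: "(\<integral>\<^sup>+\<xi>. ennreal ((g \<xi>)\<^sup>2) \<partial>noise_law d) \<le> ennreal (exp 2)"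
  proof -
    \<comment> \<open>The square of the mixture is a sum over pairs of independent spike patterns,
      whose integrals depend only on the number of agreements.\<close>
    have g2: "ennreal ((g \<xi>)\<^sup>2) = (\<Sum>\<omega>\<in>\<Omega>. \<Sum>\<omega>'\<in>\<Omega>. ennreal (?w\<^sup>2) *
        ennreal (shift_density d (a \<omega>) \<xi> * shift_density d (a \<omega>') \<xi>))" for \<xi>
    proof -
      have "(g \<xi>)\<^sup>2 = (\<Sum>\<omega>\<in>\<Omega>. \<Sum>\<omega>'\<in>\<Omega>. ?w\<^sup>2 * (shift_density d (a \<omega>) \<xi> * shift_density d (a \<omega>') \<xi>))"
        unfolding g_def power2_eq_square sum_product by (simp only: ac_simps)
      then show ?thesis
        by (simp only: sum_ennreal[symmetric] sum_nonneg ennreal_mult mult_nonneg_nonneg zero_le_power2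
            shift_density_nonneg)
    qed
    have "(\<integral>\<^sup>+\<xi>. ennreal ((g \<xi>)\<^sup>2) \<partial>noise_law d) = (\<Sum>\<omega>\<in>\<Omega>. \<Sum>\<omega>'\<in>\<Omega>. ennreal (?w\<^sup>2) *
        (\<integral>\<^sup>+\<xi>. ennreal (shift_density d (a \<omega>) \<xi> * shift_density d (a \<omega>') \<xi>) \<partial>noise_law d))"
      unfolding g2
      by (subst nn_integral_sum, measurable, intro sum.cong refl, subst nn_integral_sum, measurable,
          intro sum.cong refl nn_integral_cmult, measurable)
    also have "\<dots> = (\<Sum>\<omega>\<in>\<Omega>. \<Sum>\<omega>'\<in>\<Omega>. ennreal (?w\<^sup>2 * exp L ^ card {i \<in> {..<s}. \<omega> i = \<omega>' i}))"
      unfolding nn_integral_shift_density_mult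
      by (intro sum.cong refl) (simp add: inner exp_of_nat_mult[symmetric] ennreal_mult mult.commute)
    also have "\<dots> = ennreal (\<Sum>\<omega>\<in>\<Omega>. \<Sum>\<omega>'\<in>\<Omega>. ?w\<^sup>2 * exp L ^ card {i \<in> {..<s}. \<omega> i = \<omega>' i})"
      by (simp add: sum_nonneg)
    also have "(\<Sum>\<omega>\<in>\<Omega>. \<Sum>\<omega>'\<in>\<Omega>. ?w\<^sup>2 * exp L ^ card {i \<in> {..<s}. \<omega> i = \<omega>' i})
        = (\<Sum>\<omega>\<in>\<Omega>. ?w\<^sup>2 * (real m - 1 + exp L) ^ s)"
      unfolding sum_distrib_left[symmetric] using sum_PiE_agreements[OF \<Omega>, folded \<Omega>_def] by simp
    also have "\<dots> = ((real m - 1 + exp L) / real m) ^ s"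
      using card_pos m(1) by (simp add: power2_eq_square power_divide card_\<Omega>)
    \<comment> \<open>Combine d \<le> 2 s m with 1 + u \<le> exp u; the s-th power then no longer
      depends on \<open>s\<close> or \<open>d\<close>.\<close>
    also have "\<dots> \<le> exp (2 / real s) ^ s"
    proof (rule power_mono)
      have "real d / (real s)\<^sup>2 \<le> 2 * real s * real m / (real s)\<^sup>2"
        using m(3) by (intro divide_right_mono) auto
      also have "\<dots> = 2 / real s * real m"
        using s by (simp add: power2_eq_square)
      finally have "(real m - 1 + exp L) / real m \<le> 1 + 2 / real s"
        using m(1) unfolding L(2) by (simp add: field_simps)
      also have "\<dots> \<le> exp (2 / real s)"
        by (rule exp_ge_add_one_self)
      finally show "(real m - 1 + exp L) / real m \<le> exp (2 / real s)" .
      show "0 \<le> (real m - 1 + exp L) / real m"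
        using m(1) by simp
    qed
    also have "exp (2 / real s) ^ s = exp 2"
      using s by (simp add: exp_of_nat_mult[symmetric])
    finally show ?thesis
      by (simp add: ennreal_leI)
  qed
  have "N\<^sup>2 \<le> 2 * (1 + exp 2) * R"
  proof (rule second_moment_method_bound[OF prob_space_noise_law U g_meas _ mass second _ _ _ null alt])
    show "0 \<le> g \<xi>" for \<xi>
      by (simp add: g_def sum_nonneg shift_density_nonneg)
    show "0 < N"
      using \<sigma> s L by (simp add: N_def)
  qed (use real in auto)
  moreover have "N\<^sup>2 = \<sigma>\<^sup>2 * (real s * L)"
    using L by (simp add: N_def power_mult_distrib)
  ultimately have "\<sigma>\<^sup>2 * (real s * L) / (2 * (1 + exp 2)) \<le> R"
    by (simp add: divide_le_eq add_pos_pos mult.commute)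
  then show ?thesis
    using real by (simp add: L_def ennreal_leI)
qed

lemma B0_mono: "s \<le> s' \<Longrightarrow> B0 d s \<subseteq> B0 d s'"
  by (auto simp: B0_def)

text \<open>The dense regime determines the constant 8; in the sparse regime the stronger constant 2
  is simply weakened.\<close>

lemma psi_sqrtQ_lower_bound:
  assumes s: "1 \<le> s" "s \<le> d" and \<sigma>: "0 < \<sigma>" and T: "T \<in> estimators d"
  shows "ennreal (1 / (8 * (1 + exp 2)) * psi_sqrtQ \<sigma> s d) \<le> (SUP \<theta>\<in>B0 d s. norm_risk d \<sigma> T \<theta>)"
proof (cases "real s < sqrt (real d)")
  case True
  let ?r = "\<sigma>\<^sup>2 * (real s * ln (1 + real d / (real s)\<^sup>2))"
  have "psi_sqrtQ \<sigma> s d = ?r"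
    using True by (simp add: psi_sqrtQ_def)
  then have "1 / (8 * (1 + exp 2)) * psi_sqrtQ \<sigma> s d = ?r / (8 * (1 + exp 2))"
    by (simp only: times_divide_eq_left mult_1)
  also have "\<dots> \<le> ?r / (2 * (1 + exp 2))"
  proof -
    have "0 < 1 + exp (2::real)"
      by (simp add: add_pos_pos)
    then show ?thesis
      by (intro divide_left_mono mult_nonneg_nonneg mult_right_mono mult_pos_pos) auto
  qed
  finally show ?thesis
    by (rule order_trans[OF ennreal_leI minimax_risk_lower_bound[OF s \<sigma> T]])
next
  case False
  \<comment> \<open>At this sparsity the logarithm is at least ln 2 \<ge> 1/2 and s' \<ge> sqrt d /
    2, so the rate is at least sqrt d / 4. Multiplied with the factor 2 of
    \<open>minimax_risk_lower_bound\<close> this gives 8.\<close>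
  define s' where "s' = nat \<lfloor>sqrt (real d)\<rfloor>"
  have d: "1 \<le> sqrt (real d)"
    using s by simp
  have s'1: "1 \<le> s'"
    using d by (simp add: s'_def le_nat_floor)
  have s'_le: "real s' \<le> sqrt (real d)"
    using d by (simp add: s'_def)
  have s'_ge: "sqrt (real d) \<le> 2 * real s'"
  proof -
    have "real s' = of_int \<lfloor>sqrt (real d)\<rfloor>"
      by (simp add: s'_def)
    then show ?thesis
      using s'1 real_of_int_floor_add_one_gt[of "sqrt (real d)"] by linarith
  qed
  have s's: "s' \<le> s"
    using s'_le False by linarith
  then have s'd: "s' \<le> d"
    using s by simp
  have "(real s')\<^sup>2 \<le> real d"
    using s'_le power_mono[OF s'_le, of 2] by simp
  then have "1 \<le> real d / (real s')\<^sup>2"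
    using s'1 by simp
  then have "ln 2 \<le> ln (1 + real d / (real s')\<^sup>2)"
    by (intro ln_mono) auto
  then have "1 / 2 \<le> ln (1 + real d / (real s')\<^sup>2)"
    using ln2_ge_two_thirds by simp
  then have "sqrt (real d) / 2 * (1 / 2) \<le> real s' * ln (1 + real d / (real s')\<^sup>2)"
    using s'_ge by (intro mult_mono) auto
  then have "\<sigma>\<^sup>2 * (sqrt (real d) / 4) / (2 * (1 + exp 2))
      \<le> \<sigma>\<^sup>2 * (real s' * ln (1 + real d / (real s')\<^sup>2)) / (2 * (1 + exp 2))"
    by (intro divide_right_mono mult_left_mono) (auto intro: add_nonneg_nonneg)
  also have "\<sigma>\<^sup>2 * (sqrt (real d) / 4) / (2 * (1 + exp 2)) = 1 / (8 * (1 + exp 2)) * psi_sqrtQ \<sigma> s d"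
    using False by (simp add: psi_sqrtQ_def)
  finally have "ennreal (1 / (8 * (1 + exp 2)) * psi_sqrtQ \<sigma> s d) \<le> (SUP \<theta>\<in>B0 d s'. norm_risk d \<sigma> T \<theta>)"
    by (rule order_trans[OF ennreal_leI minimax_risk_lower_bound[OF s'1 s'd \<sigma> T]])
  also have "\<dots> \<le> (SUP \<theta>\<in>B0 d s. norm_risk d \<sigma> T \<theta>)"
    by (rule SUP_subset_mono[OF B0_mono[OF s's]]) simp
  finally show ?thesis .
qed

theorem theorem8:
  shows "\<exists>c::real. \<exists>C::real. c > 0 \<and> C > 0 \<and>
    (\<forall>(s::nat) (d::nat) (\<sigma>::real). 1 \<le> s \<and> s \<le> d \<and> \<sigma> > 0 \<longrightarrow>
       (SUP \<theta>\<in>B0 d s. norm_risk d \<sigma> (N_hat \<sigma> s d) \<theta>) \<le> ennreal (C * psi_sqrtQ \<sigma> s d) \<and>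
       (INF T\<in>estimators d. SUP \<theta>\<in>B0 d s. norm_risk d \<sigma> T \<theta>) \<ge> ennreal (c * psi_sqrtQ \<sigma> s d))"
proof (intro exI conjI allI impI)
  \<comment> \<open>The two positivity goals fix the witnesses \<open>c\<close> and \<open>C\<close>
    as the constants of \<open>psi_sqrtQ_lower_bound\<close> and
    \<open>N_hat_risk_upper_bound\<close>.\<close>
  show "0 < 1 / (8 * (1 + exp 2 :: real))"
    by (simp add: add_pos_pos)
  show "(0::real) < 4914"
    by simp
  fix s d :: nat and \<sigma> :: real
  assume *: "1 \<le> s \<and> s \<le> d \<and> \<sigma> > 0"
  show "(SUP \<theta>\<in>B0 d s. norm_risk d \<sigma> (N_hat \<sigma> s d) \<theta>) \<le> ennreal (4914 * psi_sqrtQ \<sigma> s d)"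
    using * by (intro SUP_least N_hat_risk_upper_bound) auto
  show "(INF T\<in>estimators d. SUP \<theta>\<in>B0 d s. norm_risk d \<sigma> T \<theta>)
      \<ge> ennreal (1 / (8 * (1 + exp 2)) * psi_sqrtQ \<sigma> s d)"
    using * by (intro INF_greatest psi_sqrtQ_lower_bound) auto
qed

end
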